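(* Let $G$ be a locally nilpotent torsion group and let $R$ be a $G$-adapted ring. Then for every subgroup $H \leq G$, $$\mathrm{N}_{\mathrm{U}(RG)}(H) = \mathrm{N}_G(H)\cdot \mathrm{C}_{\mathrm{U}(RG)}(H).$$ In particular, this holds for all subgroups $H$ of $G$ whenever $G$ is a finite nilpotent group and $R$ is a $G$-adapted ring.
   Context: A group is locally nilpotent if every finitely generated subgroup is nilpotent. For a group $G$, a $G$-adapted ring is an integral domain (commutative, with $1$) of characteristic zero in which a rational prime $p$ is not invertible whenever there exists an element of order $p$ in $G$. $RG$ is the group ring of $G$ over $R$ and $\mathrm{U}(RG)$ its group of units; $G$ is regarded as a subgroup of $\mathrm{U}(RG)$. For a group $X$ containing $H$ as a subgroup, $\mathrm{N}_X(H)=\{x\in X : x^{-1}Hx=H\}$ is the normalizer and $\mathrm{C}_X(H)$ the centralizer of $H$ in $X$. *)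

theory Defs
  imports "HOL-Algebra.Algebra"
begin

section \<open>Groups\<close>

definition torsion_group :: "('g, 'm) monoid_scheme \<Rightarrow> bool" where
  "torsion_group G \<longleftrightarrow>
     group G \<and> (\<forall>x\<in>carrier G. \<exists>n::nat. n > 0 \<and> x [^]\<^bsub>G\<^esub> n = \<one>\<^bsub>G\<^esub>)"

primrec lower_central_series :: "('g, 'm) monoid_scheme \<Rightarrow> nat \<Rightarrow> 'g set" where
  "lower_central_series G 0 = carrier G"
| "lower_central_series G (Suc n) =
     generate G {x \<otimes>\<^bsub>G\<^esub> y \<otimes>\<^bsub>G\<^esub> inv\<^bsub>G\<^esub> x \<otimes>\<^bsub>G\<^esub> inv\<^bsub>G\<^esub> y | x y.
                 x \<in> lower_central_series G n \<and> y \<in> carrier G}"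

definition nilpotent_group :: "('g, 'm) monoid_scheme \<Rightarrow> bool" where
  "nilpotent_group G \<longleftrightarrow> group G \<and> (\<exists>n. lower_central_series G n = {\<one>\<^bsub>G\<^esub>})"

definition locally_nilpotent_group :: "('g, 'm) monoid_scheme \<Rightarrow> bool" where
  "locally_nilpotent_group G \<longleftrightarrow>
     group G \<and> (\<forall>S. finite S \<and> S \<subseteq> carrier G \<longrightarrow> nilpotent_group (G\<lparr>carrier := generate G S\<rparr>))"

definition centralizer :: "('g, 'm) monoid_scheme \<Rightarrow> 'g set \<Rightarrow> 'g set" where
  "centralizer G H = {x \<in> carrier G. \<forall>h\<in>H. x \<otimes>\<^bsub>G\<^esub> h = h \<otimes>\<^bsub>G\<^esub> x}"

text \<open>The library's \<^const>\<open>normalizer\<close> is stated with \<open>x H x\<inverse> = H\<close>; this is the same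
  set as the one given by \<open>x\<inverse> H x = H\<close>.\<close>

lemma (in group) normalizer_eq:
  assumes "H \<subseteq> carrier G"
  shows "normalizer G H = {x \<in> carrier G. inv x <# H #> x = H}"
proof -
  have *: "inv x <# (x <# H #> inv x) #> x = H" if "x \<in> carrier G" for x
    using that assms
    by (simp add: coset_assoc coset_mult_assoc l_coset_subset_G r_coset_subset_G lcos_m_assoc
                  lcos_mult_one coset_mult_one)
  have "x <# H #> inv x = H \<longleftrightarrow> inv x <# H #> x = H" if x: "x \<in> carrier G" for x
    using *[OF x] *[of "inv x"] x by fastforce
  then show ?thesis
    using assms by (auto simp: normalizer_def stabilizer_def)
qed


section \<open>Adapted rings and group rings\<close>

definition adapted_ring :: "('g, 'm) monoid_scheme \<Rightarrow> ('r, 'n) ring_scheme \<Rightarrow> bool" where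
  "adapted_ring G R \<longleftrightarrow>
     domain R \<and>
     (\<forall>n::nat. n > 0 \<longrightarrow> [n] \<cdot>\<^bsub>R\<^esub> \<one>\<^bsub>R\<^esub> \<noteq> \<zero>\<^bsub>R\<^esub>) \<and>
     (\<forall>p::nat. Factorial_Ring.prime p \<and> (\<exists>g\<in>carrier G. group.ord G g = p) \<longrightarrow>
        [p] \<cdot>\<^bsub>R\<^esub> \<one>\<^bsub>R\<^esub> \<notin> Units R)"

text \<open>Elements of the group ring are the finitely supported functions from the group to the
  coefficient ring; since HOL functions are total, they are taken to be zero outside the
  carrier of the group.\<close>

definition group_ring :: "('r, 'n) ring_scheme \<Rightarrow> ('g, 'm) monoid_scheme \<Rightarrow> ('g \<Rightarrow> 'r) ring" where
  "group_ring R G =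
     \<lparr>carrier = {a. (\<forall>x\<in>carrier G. a x \<in> carrier R) \<and> (\<forall>x. x \<notin> carrier G \<longrightarrow> a x = \<zero>\<^bsub>R\<^esub>) \<and>
                    finite {x. a x \<noteq> \<zero>\<^bsub>R\<^esub>}},
      monoid.mult = (\<lambda>a b x. if x \<in> carrier G
        then \<Oplus>\<^bsub>R\<^esub>y\<in>{y. a y \<noteq> \<zero>\<^bsub>R\<^esub>}. a y \<otimes>\<^bsub>R\<^esub> b (inv\<^bsub>G\<^esub> y \<otimes>\<^bsub>G\<^esub> x)
        else \<zero>\<^bsub>R\<^esub>),
      monoid.one = (\<lambda>x. if x = \<one>\<^bsub>G\<^esub> then \<one>\<^bsub>R\<^esub> else \<zero>\<^bsub>R\<^esub>),
      ring.zero = (\<lambda>x. \<zero>\<^bsub>R\<^esub>),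
      ring.add = (\<lambda>a b x. a x \<oplus>\<^bsub>R\<^esub> b x)\<rparr>"

text \<open>The embedding of the group into the units of its group ring.\<close>

definition group_ring_of :: "('r, 'n) ring_scheme \<Rightarrow> ('g, 'm) monoid_scheme \<Rightarrow> 'g \<Rightarrow> 'g \<Rightarrow> 'r" where
  "group_ring_of R G g = (\<lambda>x. if x = g then \<one>\<^bsub>R\<^esub> else \<zero>\<^bsub>R\<^esub>)"

abbreviation group_ring_units ::
    "('r, 'n) ring_scheme \<Rightarrow> ('g, 'm) monoid_scheme \<Rightarrow> ('g \<Rightarrow> 'r) monoid" where
  "group_ring_units R G \<equiv> units_of (group_ring R G)"

end

theory Submission
  imports Defs
begin

text \<open>
  Let \<open>u\<close> be a unit of the group ring normalizing \<open>H\<close>. Conjugation by \<open>u\<close> induces an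
  automorphism \<open>s\<close> of \<open>H\<close>, characterized by \<open>h u = u s(h)\<close>, and the theorem says exactly that
  \<open>s\<close> is also conjugation by some \<open>g \<in> G\<close>: then \<open>g\<close> normalizes \<open>H\<close> and \<open>g\<^sup>-\<^sup>1 u\<close> centralizes it
  (\<open>normalizer_image_eq_mult_centralizer\<close>).

  For one prime \<open>p\<close> such a \<open>g\<close> is found in the support of \<open>u\<close>, by an argument of Coleman. The
  equation \<open>h u s(h)\<^sup>-\<^sup>1 = u\<close> means that the coefficients of \<open>u\<close> are constant on the orbits of the
  action \<open>g \<mapsto> h g s(h)\<^sup>-\<^sup>1\<close> of \<open>H\<close> on the support. Restrict the action to the \<open>p\<close>-elements of
  \<open>H\<close>: all orbits have \<open>p\<close>-power size, so if there were no fixed point, the sum of all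
  coefficients of \<open>u\<close>, which is a unit, would be a multiple of \<open>p\<close>, and \<open>p\<close> would be invertible
  in \<open>R\<close>. A fixed point \<open>g\<close> satisfies \<open>s(h) = g\<^sup>-\<^sup>1 h g\<close> for all \<open>p\<close>-elements \<open>h\<close> (\<open>coleman\<close>).

  Local nilpotency makes the \<open>p\<close>-elements a subgroup (\<open>power_torsion_subgroup\<close>), which is needed
  for that action, and makes elements of coprime orders commute (\<open>coprime_exponents_commute\<close>).
  The latter allows the solutions for different primes to be glued: only the \<open>p\<close>-part of the
  fixed point belonging to \<open>p\<close> acts on \<open>p\<close>-elements, and it does not disturb the other primes.
  Since the support of \<open>u\<close> is finite, all but finitely many primes \<open>p\<close> do not divide the order
  of any of its elements. For these, the fixed point commutes with all \<open>p\<close>-elements, and \<open>s\<close> is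
  trivial on them. Hence a finite product suffices even when \<open>H\<close> is infinite
  (\<open>unit_conjugation_is_group_conjugation\<close>).

  A finite nilpotent group is a locally nilpotent torsion group, so it is a special case.
\<close>

section \<open>Torsion in locally nilpotent groups\<close>

text \<open>
  For a prime number \<open>n\<close> these are the \<open>n\<close>-elements. Allowing all \<open>n\<close> lets one treat elements
  whose order has several prime divisors, which \<open>coprime_exponents_commute\<close> needs.
\<close>

definition power_torsion :: "('g, 'm) monoid_scheme \<Rightarrow> nat \<Rightarrow> 'g set" where
  "power_torsion G n = {x \<in> carrier G. \<exists>k::nat. x [^]\<^bsub>G\<^esub> (n ^ k) = \<one>\<^bsub>G\<^esub>}"

lemma (in group) central_power_torsion_subgroup:
  "subgroup {z \<in> power_torsion G n. \<forall>y\<in>carrier G. z \<otimes> y = y \<otimes> z} G"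
proof (rule subgroupI)
  show "{z \<in> power_torsion G n. \<forall>y\<in>carrier G. z \<otimes> y = y \<otimes> z} \<noteq> {}"
    by (rule ex_in_conv[THEN iffD1], rule exI[of _ \<one>]) (auto simp: power_torsion_def)
next
  fix a assume a: "a \<in> {z \<in> power_torsion G n. \<forall>y\<in>carrier G. z \<otimes> y = y \<otimes> z}"
  have "inv a \<otimes> y = y \<otimes> inv a" if y: "y \<in> carrier G" for y
  proof -
    have "a \<otimes> y = y \<otimes> a" "a \<in> carrier G" using a y by (auto simp: power_torsion_def)
    then show ?thesis using y by (metis inv_closed inv_solve_left m_assoc m_closed inv_solve_right')
  qed
  moreover have "\<exists>k::nat. inv a [^] (n ^ k) = \<one>"
    using a by (auto simp: power_torsion_def nat_pow_inv)
  ultimately show "inv a \<in> {z \<in> power_torsion G n. \<forall>y\<in>carrier G. z \<otimes> y = y \<otimes> z}"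
    using a by (auto simp: power_torsion_def)
next
  fix a b
  assume a: "a \<in> {z \<in> power_torsion G n. \<forall>y\<in>carrier G. z \<otimes> y = y \<otimes> z}"
    and b: "b \<in> {z \<in> power_torsion G n. \<forall>y\<in>carrier G. z \<otimes> y = y \<otimes> z}"
  have ac: "a \<in> carrier G" and bc: "b \<in> carrier G"
    using a b by (auto simp: power_torsion_def)
  obtain k l where k: "a [^] (n ^ k) = \<one>" and l: "b [^] (n ^ l) = \<one>"
    using a b by (auto simp: power_torsion_def)
  have "a [^] (n ^ (k + l)) = \<one>"
    using k ac by (metis nat_pow_one nat_pow_pow power_add)
  moreover have "b [^] (n ^ (k + l)) = \<one>"
    using l bc by (metis nat_pow_one nat_pow_pow power_add mult.commute)
  ultimately have "(a \<otimes> b) [^] (n ^ (k + l)) = \<one>"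
    using a ac bc by (simp add: pow_mult_distrib)
  moreover have "(a \<otimes> b) \<otimes> y = y \<otimes> (a \<otimes> b)" if y: "y \<in> carrier G" for y
  proof -
    have "a \<otimes> y = y \<otimes> a" "b \<otimes> y = y \<otimes> b" using a b y by auto
    then show ?thesis using y ac bc by (metis m_assoc)
  qed
  ultimately show "a \<otimes> b \<in> {z \<in> power_torsion G n. \<forall>y\<in>carrier G. z \<otimes> y = y \<otimes> z}"
    using ac bc by (auto simp: power_torsion_def)
qed (auto simp: power_torsion_def)

lemma (in normal) rcos_eq_self_iff:
  assumes "x \<in> carrier G"
  shows "H #> x = H \<longleftrightarrow> x \<in> H"
  using coset_join1[OF _ assms subgroup_axioms] coset_join2[OF assms subgroup_axioms] by metis

lemma (in normal) rcos_commute_if_commutator_mem: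
  assumes "a \<in> carrier G" "b \<in> carrier G" "a \<otimes> b \<otimes> inv a \<otimes> inv b \<in> H"
  shows "H #> (a \<otimes> b) = H #> (b \<otimes> a)"
proof -
  have "a \<otimes> b = (a \<otimes> b \<otimes> inv a \<otimes> inv b) \<otimes> (b \<otimes> a)"
    using assms(1,2) by (simp add: m_assoc inv_solve_left) (metis assms(1,2) inv_closed l_inv m_assoc m_closed r_one)
  then have "a \<otimes> b \<in> H #> (b \<otimes> a)"
    using assms by (metis rcosI m_closed subset)
  then show ?thesis
    using assms repr_independence[OF _ _ subgroup_axioms] by simp
qed

text \<open>
  Central elements whose order divides a power of \<open>n\<close> form a subgroup of the quotient, so it is
  enough to know that the generators land in it.
\<close>

lemma (in normal) generate_power_torsion_mod:
  fixes n :: nat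
  assumes S: "S \<subseteq> carrier G"
    and tors: "\<And>s. s \<in> S \<Longrightarrow> \<exists>k::nat. s [^] (n ^ k) \<in> H"
    and cent: "\<And>s y. s \<in> S \<Longrightarrow> y \<in> carrier G \<Longrightarrow> s \<otimes> y \<otimes> inv s \<otimes> inv y \<in> H"
    and x: "x \<in> generate G S"
  shows "\<exists>k::nat. x [^] (n ^ k) \<in> H"
proof -
  interpret Q: group "G Mod H" by (rule factorgroup_is_group)
  interpret pi: group_hom G "G Mod H" "\<lambda>a. H #> a"
    by unfold_locales (rule r_coset_hom_Mod)
  let ?Z = "{z \<in> power_torsion (G Mod H) n. \<forall>y\<in>carrier (G Mod H). z \<otimes>\<^bsub>G Mod H\<^esub> y = y \<otimes>\<^bsub>G Mod H\<^esub> z}"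
  \<comment> \<open>\<open>?Z\<close> is the subgroup of \<open>central_power_torsion_subgroup\<close> in the quotient.\<close>
  have "(\<lambda>a. H #> a) ` S \<subseteq> ?Z"
  proof clarify
    fix s assume s: "s \<in> S"
    then have sc: "s \<in> carrier G" using S by auto
    obtain k where "s [^] (n ^ k) \<in> H" using tors[OF s] by blast
    then have "(H #> s) [^]\<^bsub>G Mod H\<^esub> (n ^ k) = \<one>\<^bsub>G Mod H\<^esub>"
      using sc by (simp add: FactGroup_pow rcos_eq_self_iff)
    moreover have "(H #> s) \<otimes>\<^bsub>G Mod H\<^esub> y = y \<otimes>\<^bsub>G Mod H\<^esub> (H #> s)" if "y \<in> carrier (G Mod H)" for y
    proof -
      obtain b where b: "b \<in> carrier G" "y = H #> b"
        using \<open>y \<in> carrier (G Mod H)\<close> by (auto simp: carrier_FactGroup)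
      then show ?thesis
        using rcos_commute_if_commutator_mem[OF sc b(1) cent[OF s b(1)]] sc
        by (metis pi.hom_mult)
    qed
    ultimately show "(H #> s) \<in> power_torsion (G Mod H) n \<and>
        (\<forall>y\<in>carrier (G Mod H). (H #> s) \<otimes>\<^bsub>G Mod H\<^esub> y = y \<otimes>\<^bsub>G Mod H\<^esub> (H #> s))"
      using sc pi.hom_closed by (auto simp only: power_torsion_def)
  qed
  then have "generate (G Mod H) ((\<lambda>a. H #> a) ` S) \<subseteq> ?Z"
    by (intro Q.generate_subgroup_incl Q.central_power_torsion_subgroup)
  then have "H #> x \<in> ?Z"
    using pi.generate_img[OF S] x by blast
  moreover have "x \<in> carrier G" using x S generate_in_carrier by blast
  ultimately show ?thesis
    by (auto simp: power_torsion_def FactGroup_pow rcos_eq_self_iff)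
qed

lemma (in group) conj_nat_pow:
  assumes "g \<in> carrier G" "x \<in> carrier G"
  shows "(g \<otimes> x \<otimes> inv g) [^] (n::nat) = g \<otimes> x [^] n \<otimes> inv g"
  using assms
  by (induction n) (auto simp: m_assoc inv_solve_left')

text \<open>
  The \<open>m\<close>-th power of \<open>a\<^sup>-\<^sup>1 z = b a\<^sup>-\<^sup>1 b\<^sup>-\<^sup>1\<close> can be computed in two ways: it is \<open>a\<^sup>-\<^sup>m z\<^sup>m\<close> because
  \<open>z\<close> commutes with \<open>a\<close>, and it is \<open>b a\<^sup>-\<^sup>m b\<^sup>-\<^sup>1 = a\<^sup>-\<^sup>m\<close> because \<open>a\<^sup>m\<close> commutes with \<open>b\<close>.
\<close>

lemma (in group) commutator_pow_eq_one:
  assumes a: "a \<in> carrier G" and b: "b \<in> carrier G"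
    and z: "z = a \<otimes> b \<otimes> inv a \<otimes> inv b" and za: "z \<otimes> inv a = inv a \<otimes> z"
    and ab: "a [^] (m::nat) \<otimes> b = b \<otimes> a [^] m"
  shows "z [^] m = \<one>"
proof -
  have zc: "z \<in> carrier G" using a b z by simp
  have cancel: "inv x \<otimes> (x \<otimes> y) = y" if "x \<in> carrier G" "y \<in> carrier G" for x y
    using that by (simp flip: m_assoc)
  have "z = a \<otimes> (b \<otimes> inv a \<otimes> inv b)"
    unfolding z using a b by (simp only: m_assoc m_closed inv_closed)
  then have "inv a \<otimes> z = b \<otimes> inv a \<otimes> inv b"
    using a b cancel by simp
  then have "(inv a \<otimes> z) [^] m = b \<otimes> inv (a [^] m) \<otimes> inv b"
    using a b by (simp add: conj_nat_pow nat_pow_inv)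
  also have "b \<otimes> inv (a [^] m) = inv (a [^] m) \<otimes> ((a [^] m \<otimes> b) \<otimes> inv (a [^] m))"
    using a b cancel by (simp add: m_assoc)
  also have "\<dots> = inv (a [^] m) \<otimes> b"
    using a b by (simp add: ab m_assoc)
  finally have "(inv a \<otimes> z) [^] m = inv (a [^] m)"
    using a b by (simp add: m_assoc)
  moreover have "(inv a \<otimes> z) [^] m = inv (a [^] m) \<otimes> z [^] m"
    using a zc za by (simp add: pow_mult_distrib nat_pow_inv)
  ultimately show ?thesis using a zc by simp
qed

text \<open>
  This is \<open>commutator_pow_eq_one\<close> in the quotient by \<open>H\<close>.
\<close>

lemma (in normal) commutator_pow_mem:
  assumes a: "a \<in> carrier G" and b: "b \<in> carrier G"
    and z: "z = a \<otimes> b \<otimes> inv a \<otimes> inv b"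
    and za: "z \<otimes> inv a \<otimes> inv z \<otimes> inv (inv a) \<in> H"
    and ab: "a [^] (m::nat) \<otimes> b \<otimes> inv (a [^] m) \<otimes> inv b \<in> H"
  shows "z [^] m \<in> H"
proof -
  interpret Q: group "G Mod H" by (rule factorgroup_is_group)
  interpret pi: group_hom G "G Mod H" "\<lambda>a. H #> a"
    by unfold_locales (rule r_coset_hom_Mod)
  have zc: "z \<in> carrier G" using a b z by simp
  have "(H #> z) [^]\<^bsub>G Mod H\<^esub> m = \<one>\<^bsub>G Mod H\<^esub>"
  proof (rule Q.commutator_pow_eq_one)
    show "H #> a \<in> carrier (G Mod H)" "H #> b \<in> carrier (G Mod H)"
      using a b by (auto intro: pi.hom_closed)
    show "H #> z = (H #> a) \<otimes>\<^bsub>G Mod H\<^esub> (H #> b) \<otimes>\<^bsub>G Mod H\<^esub> inv\<^bsub>G Mod H\<^esub> (H #> a)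
        \<otimes>\<^bsub>G Mod H\<^esub> inv\<^bsub>G Mod H\<^esub> (H #> b)"
      unfolding z using a b by (simp only: pi.hom_mult pi.hom_inv m_closed inv_closed)
    show "(H #> z) \<otimes>\<^bsub>G Mod H\<^esub> inv\<^bsub>G Mod H\<^esub> (H #> a) = inv\<^bsub>G Mod H\<^esub> (H #> a) \<otimes>\<^bsub>G Mod H\<^esub> (H #> z)"
      using rcos_commute_if_commutator_mem[OF zc _ za] a zc
      by (simp only: pi.hom_mult[symmetric] pi.hom_inv[symmetric] inv_closed)
    show "(H #> a) [^]\<^bsub>G Mod H\<^esub> m \<otimes>\<^bsub>G Mod H\<^esub> (H #> b) = (H #> b) \<otimes>\<^bsub>G Mod H\<^esub> (H #> a) [^]\<^bsub>G Mod H\<^esub> m"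
      using rcos_commute_if_commutator_mem[OF _ b ab] a b
      by (simp only: FactGroup_pow pi.hom_mult[symmetric] nat_pow_closed)
  qed
  then show ?thesis using zc by (simp add: FactGroup_pow rcos_eq_self_iff)
qed

lemma (in group) lower_central_series_normal: "lower_central_series G i \<lhd> G"
proof (induction i)
  case 0
  show ?case by (simp add: normal_self)
next
  case (Suc i)
  interpret L: normal "lower_central_series G i" G by (rule Suc)
  show ?case
  proof (simp only: lower_central_series.simps, rule normal_generateI)
    fix h g assume "h \<in> {x \<otimes> y \<otimes> inv x \<otimes> inv y |x y. x \<in> lower_central_series G i \<and> y \<in> carrier G}"
      and g: "g \<in> carrier G"
    then obtain x y where x: "x \<in> lower_central_series G i" and y: "y \<in> carrier G"
      and h: "h = x \<otimes> y \<otimes> inv x \<otimes> inv y" by blast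
    have xc: "x \<in> carrier G" using x L.subset by auto
    let ?c = "\<lambda>z. g \<otimes> z \<otimes> inv g"
    have "g \<otimes> h \<otimes> inv g = ?c x \<otimes> ?c y \<otimes> inv (?c x) \<otimes> inv (?c y)"
      using g xc y unfolding h by (simp add: inv_mult_group m_assoc inv_solve_left' flip: m_assoc) (simp add: m_assoc inv_solve_left')
    moreover have "?c x \<in> lower_central_series G i"
      using x g by (rule L.inv_op_closed2[rotated])
    ultimately show "g \<otimes> h \<otimes> inv g \<in> {x \<otimes> y \<otimes> inv x \<otimes> inv y |x y. x \<in> lower_central_series G i \<and> y \<in> carrier G}"
      using g y by blast
  qed (use L.subset in auto)
qed

lemma (in group) commutator_in_lower_central_series:
  assumes "x \<in> lower_central_series G i" "y \<in> carrier G"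
  shows "x \<otimes> y \<otimes> inv x \<otimes> inv y \<in> lower_central_series G (Suc i)"
  unfolding lower_central_series.simps using assms by (intro generate.incl) blast

lemma (in group) lower_central_series_subset: "lower_central_series G i \<subseteq> carrier G"
  using lower_central_series_normal normal_imp_subgroup subgroup.subset by blast

text \<open>
  Each term of the series is generated modulo the next one by central elements, so
  \<open>generate_power_torsion_mod\<close> reduces the claim to the generators. For the top term these are
  the elements of \<open>S\<close>; below, they are commutators \<open>[a,b]\<close> with \<open>a\<close> one term higher up. If
  \<open>a\<^sup>m\<close> lies in the term containing \<open>[a,b]\<close>, then \<open>a\<^sup>m\<close> is central modulo the next term, and
  hence \<open>[a,b]\<^sup>m\<close> is trivial there.
\<close>

lemma (in group) lower_central_series_power_descends:
  assumes S: "S \<subseteq> power_torsion G n" and gen: "carrier G = generate G S"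
    and x: "x \<in> lower_central_series G i"
  shows "\<exists>k::nat. x [^] (n ^ k) \<in> lower_central_series G (Suc i)"
  using x
proof (induction i arbitrary: x)
  case 0
  show ?case
  proof (rule normal.generate_power_torsion_mod[OF lower_central_series_normal])
    show "S \<subseteq> carrier G" using S by (auto simp: power_torsion_def)
    show "x \<in> generate G S" using 0 gen by simp
    show "\<exists>k::nat. s [^] (n ^ k) \<in> lower_central_series G (Suc 0)" if s: "s \<in> S" for s
    proof -
      obtain k where "s [^] (n ^ k) = \<one>" using s S unfolding power_torsion_def by blast
      then show ?thesis
        using subgroup.one_closed[OF normal_imp_subgroup[OF lower_central_series_normal]] by metis
    qed
    show "s \<otimes> y \<otimes> inv s \<otimes> inv y \<in> lower_central_series G (Suc 0)"
      if "s \<in> S" "y \<in> carrier G" for s y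
      using commutator_in_lower_central_series[of s 0 y] that \<open>S \<subseteq> carrier G\<close> by auto
  qed
next
  case (Suc i)
  let ?K = "lower_central_series G (Suc (Suc i))"
  let ?S = "{x \<otimes> y \<otimes> inv x \<otimes> inv y |x y. x \<in> lower_central_series G i \<and> y \<in> carrier G}"
  have S1: "?S \<subseteq> lower_central_series G (Suc i)"
    using commutator_in_lower_central_series by blast
  show ?case
  proof (rule normal.generate_power_torsion_mod[OF lower_central_series_normal])
    show "x \<in> generate G ?S" using Suc.prems unfolding lower_central_series.simps .
    show "?S \<subseteq> carrier G" using S1 lower_central_series_subset by blast
    show "s \<otimes> y \<otimes> inv s \<otimes> inv y \<in> ?K" if "s \<in> ?S" "y \<in> carrier G" for s y
      using commutator_in_lower_central_series[OF subsetD[OF S1 that(1)] that(2)] .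
    show "\<exists>k::nat. s [^] (n ^ k) \<in> ?K" if s: "s \<in> ?S" for s
    proof -
      obtain a b where a: "a \<in> lower_central_series G i" and b: "b \<in> carrier G"
        and s_eq: "s = a \<otimes> b \<otimes> inv a \<otimes> inv b" using s by blast
      have ac: "a \<in> carrier G" using a lower_central_series_subset by blast
      obtain k where k: "a [^] (n ^ k) \<in> lower_central_series G (Suc i)"
        using Suc.IH[OF a] by blast
      have "s [^] (n ^ k) \<in> ?K"
        using ac b s_eq
          commutator_in_lower_central_series[OF subsetD[OF S1 s] inv_closed[OF ac]]
          commutator_in_lower_central_series[OF k b]
        by (rule normal.commutator_pow_mem[OF lower_central_series_normal])
      then show ?thesis by blast
    qed
  qed
qed

lemma (in group) generated_by_power_torsion:
  assumes nilp: "nilpotent_group G"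
    and S: "S \<subseteq> power_torsion G n" and gen: "carrier G = generate G S"
  shows "carrier G = power_torsion G n"
proof -
  obtain c where c: "lower_central_series G c = {\<one>}"
    using nilp by (auto simp: nilpotent_group_def)
  have "\<exists>k::nat. x [^] (n ^ k) \<in> lower_central_series G i" if x: "x \<in> carrier G" for x i
  proof (induction i)
    case 0 then show ?case using x by simp
  next
    case (Suc i)
    then obtain k where "x [^] (n ^ k) \<in> lower_central_series G i" by blast
    then obtain l where "(x [^] (n ^ k)) [^] (n ^ l) \<in> lower_central_series G (Suc i)"
      using lower_central_series_power_descends[OF S gen] by blast
    then have "x [^] (n ^ (k + l)) \<in> lower_central_series G (Suc i)"
      using x by (simp only: nat_pow_pow power_add)
    then show ?case by blast
  qed
  from this[of _ c] show ?thesis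
    unfolding c by (auto simp: power_torsion_def)
qed

text \<open>
  A product of two elements lies in the subgroup they generate. This subgroup is nilpotent, and
  \<open>generated_by_power_torsion\<close> applies to it.
\<close>

lemma (in group) power_torsion_subgroup:
  assumes "locally_nilpotent_group G"
  shows "subgroup (power_torsion G n) G"
proof (rule subgroupI)
  show "power_torsion G n \<noteq> {}"
    by (rule ex_in_conv[THEN iffD1], rule exI[of _ \<one>]) (auto simp: power_torsion_def)
next
  fix a assume "a \<in> power_torsion G n"
  then show "inv a \<in> power_torsion G n" by (auto simp: power_torsion_def nat_pow_inv)
next
  fix a b assume ab: "a \<in> power_torsion G n" "b \<in> power_torsion G n"
  let ?N = "G\<lparr>carrier := generate G {a, b}\<rparr>"
  have abc: "{a, b} \<subseteq> carrier G" using ab by (auto simp: power_torsion_def)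
  have sub: "subgroup (generate G {a, b}) G" using abc by (rule generate_is_subgroup)
  have ab_in: "{a, b} \<subseteq> generate G {a, b}" by (auto intro: generate.incl)
  interpret N: group ?N using sub by (rule subgroup_imp_group)
  have pow: "x [^]\<^bsub>?N\<^esub> m = x [^] m" for x and m :: nat
    by (rule nat_pow_consistent[symmetric])
  have "{a, b} \<subseteq> power_torsion ?N n"
    using ab ab_in by (auto simp: power_torsion_def pow)
  moreover have "carrier ?N = generate ?N {a, b}"
    using generate_consistent[OF ab_in sub] by simp
  moreover have "nilpotent_group ?N"
    using assms abc by (auto simp: locally_nilpotent_group_def)
  ultimately have "carrier ?N = power_torsion ?N n"
    using N.generated_by_power_torsion by blast
  moreover have "a \<otimes> b \<in> carrier ?N"
    using ab_in by (auto intro: generate.eng)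
  ultimately show "a \<otimes> b \<in> power_torsion G n"
    using abc by (auto simp: power_torsion_def pow)
qed (auto simp: power_torsion_def)

lemma (in group) power_torsion_normal:
  assumes "locally_nilpotent_group G"
  shows "power_torsion G n \<lhd> G"
proof (rule normal_invI[OF power_torsion_subgroup[OF assms]])
  fix x h assume x: "x \<in> carrier G" and h: "h \<in> power_torsion G n"
  then obtain k where "h [^] (n ^ k) = \<one>" and hc: "h \<in> carrier G"
    by (auto simp: power_torsion_def)
  then have "(x \<otimes> h \<otimes> inv x) [^] (n ^ k) = \<one>"
    using x by (simp add: conj_nat_pow)
  then show "x \<otimes> h \<otimes> inv x \<in> power_torsion G n"
    using x hc by (auto simp: power_torsion_def)
qed

lemma (in group) coprime_pow_eq_one:
  assumes x: "x \<in> carrier G" and "x [^] (a::nat) = \<one>" "x [^] (b::nat) = \<one>" and "coprime a b"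
  shows "x = \<one>"
proof -
  have "ord x dvd a" "ord x dvd b" using assms pow_eq_id by auto
  then have "ord x = 1" using \<open>coprime a b\<close> by (metis coprime_common_divisor_nat nat_dvd_1_iff_1)
  then show ?thesis using x ord_eq_1 by blast
qed

text \<open>
  The commutator of \<open>x\<close> and \<open>y\<close> lies in two normal subgroups whose elements have orders
  dividing powers of \<open>a\<close> and of \<open>b\<close> respectively, so it is trivial.
\<close>

lemma (in group) coprime_exponents_commute:
  assumes ln: "locally_nilpotent_group G"
    and x: "x \<in> carrier G" "x [^] (a::nat) = \<one>" and y: "y \<in> carrier G" "y [^] (b::nat) = \<one>"
    and ab: "coprime a b"
  shows "x \<otimes> y = y \<otimes> x"
proof -
  interpret A: normal "power_torsion G a" G using ln by (rule power_torsion_normal)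
  interpret B: normal "power_torsion G b" G using ln by (rule power_torsion_normal)
  have "x [^] (a ^ 1) = \<one>" "y [^] (b ^ 1) = \<one>"
    using x(2) y(2) by simp_all
  then have xA: "x \<in> power_torsion G a" and yB: "y \<in> power_torsion G b"
    using x(1) y(1) unfolding power_torsion_def by blast+
  let ?z = "x \<otimes> y \<otimes> inv x \<otimes> inv y"
  have "x \<otimes> (y \<otimes> inv x \<otimes> inv y) \<in> power_torsion G a"
    using A.m_closed[OF xA A.inv_op_closed2[OF y(1) A.m_inv_closed[OF xA]]] .
  then have zA: "?z \<in> power_torsion G a"
    using x(1) y(1) by (simp only: m_assoc m_closed inv_closed)
  have zB: "?z \<in> power_torsion G b"
    using B.m_closed[OF B.inv_op_closed2[OF x(1) yB] B.m_inv_closed[OF yB]] .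
  obtain k where k: "?z [^] (a ^ k) = \<one>" using zA unfolding power_torsion_def by blast
  obtain l where l: "?z [^] (b ^ l) = \<one>" using zB unfolding power_torsion_def by blast
  have "?z = \<one>"
  proof (rule coprime_pow_eq_one[OF _ k l])
    show "?z \<in> carrier G" using x(1) y(1) by (simp only: m_closed inv_closed)
    show "coprime (a ^ k) (b ^ l)" using ab by simp
  qed
  then have "x \<otimes> y \<otimes> inv x = inv (inv y)"
    using x(1) y(1) by (intro inv_equality[symmetric]) simp_all
  then have "x \<otimes> y \<otimes> inv x = y" using y(1) by simp
  then show ?thesis using inv_solve_right[of y "x \<otimes> y" x] x(1) y(1) by simp
qed

section \<open>Group rings and their augmentation\<close>

lemma (in abelian_monoid) finsum_swap:
  assumes "finite A" "finite B" "\<And>a b. a \<in> A \<Longrightarrow> b \<in> B \<Longrightarrow> f a b \<in> carrier G"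
  shows "(\<Oplus>a\<in>A. \<Oplus>b\<in>B. f a b) = (\<Oplus>b\<in>B. \<Oplus>a\<in>A. f a b)"
  using assms(1,3)
proof (induction A rule: finite_induct)
  case empty
  then show ?case by simp
next
  case (insert x A)
  have "(\<Oplus>a\<in>insert x A. \<Oplus>b\<in>B. f a b) = (\<Oplus>b\<in>B. f x b) \<oplus> (\<Oplus>b\<in>B. \<Oplus>a\<in>A. f a b)"
    using insert by (simp add: finsum_insert finsum_closed)
  also have "\<dots> = (\<Oplus>b\<in>B. f x b \<oplus> (\<Oplus>a\<in>A. f a b))"
    using insert.prems by (intro finsum_addf[symmetric]) (auto intro!: finsum_closed)
  also have "\<dots> = (\<Oplus>b\<in>B. \<Oplus>a\<in>insert x A. f a b)"
    using insert by (intro finsum_cong') (auto intro!: finsum_closed)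
  finally show ?case .
qed

locale group_algebra = cring R + G: group G
  for R :: "('r, 'n) ring_scheme" (structure) and G :: "('g, 'm) monoid_scheme"
begin

abbreviation RG :: "('g \<Rightarrow> 'r) ring" where "RG \<equiv> group_ring R G"

abbreviation of_group :: "'g \<Rightarrow> 'g \<Rightarrow> 'r" where "of_group \<equiv> group_ring_of R G"

definition supp :: "('g \<Rightarrow> 'r) \<Rightarrow> 'g set" where
  "supp a = {x. a x \<noteq> \<zero>}"

lemma carrier_RG:
  "a \<in> carrier RG \<longleftrightarrow> (\<forall>x\<in>carrier G. a x \<in> carrier R) \<and> supp a \<subseteq> carrier G \<and> finite (supp a)"
  by (auto simp: group_ring_def supp_def)

lemma one_RG: "\<one>\<^bsub>RG\<^esub> = of_group \<one>\<^bsub>G\<^esub>"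
  by (simp add: group_ring_def group_ring_of_def)

lemma coeff_outside: "a \<in> carrier RG \<Longrightarrow> x \<notin> carrier G \<Longrightarrow> a x = \<zero>"
  unfolding carrier_RG supp_def by blast

lemma coeff_closed: "a \<in> carrier RG \<Longrightarrow> a x \<in> carrier R"
  using coeff_outside[of a x] by (cases "x \<in> carrier G") (auto simp: carrier_RG)

lemma mult_outside: "x \<notin> carrier G \<Longrightarrow> (a \<otimes>\<^bsub>RG\<^esub> b) x = \<zero>"
  by (simp add: group_ring_def)

lemma mult_eq:
  assumes a: "a \<in> carrier RG" and b: "b \<in> carrier RG"
    and S: "finite S" "supp a \<subseteq> S" and x: "x \<in> carrier G"
  shows "(a \<otimes>\<^bsub>RG\<^esub> b) x = (\<Oplus>y\<in>S. a y \<otimes> b (inv\<^bsub>G\<^esub> y \<otimes>\<^bsub>G\<^esub> x))"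
proof -
  have "(a \<otimes>\<^bsub>RG\<^esub> b) x = (\<Oplus>y\<in>supp a. a y \<otimes> b (inv\<^bsub>G\<^esub> y \<otimes>\<^bsub>G\<^esub> x))"
    using x by (simp add: group_ring_def supp_def)
  also have "\<dots> = (\<Oplus>y\<in>S. a y \<otimes> b (inv\<^bsub>G\<^esub> y \<otimes>\<^bsub>G\<^esub> x))"
    using S a b by (intro add.finprod_mono_neutral_cong_left) (auto simp: supp_def coeff_closed)
  finally show ?thesis .
qed

lemma supp_mult_subset:
  assumes a: "a \<in> carrier RG" and b: "b \<in> carrier RG"
  shows "supp (a \<otimes>\<^bsub>RG\<^esub> b) \<subseteq> supp a <#>\<^bsub>G\<^esub> supp b"
proof
  fix x assume x: "x \<in> supp (a \<otimes>\<^bsub>RG\<^esub> b)"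
  then have xc: "x \<in> carrier G" using mult_outside by (auto simp: supp_def)
  have "\<exists>y\<in>supp a. b (inv\<^bsub>G\<^esub> y \<otimes>\<^bsub>G\<^esub> x) \<noteq> \<zero>"
  proof (rule ccontr)
    assume "\<not> ?thesis"
    then have "(\<Oplus>y\<in>supp a. a y \<otimes> b (inv\<^bsub>G\<^esub> y \<otimes>\<^bsub>G\<^esub> x)) = (\<Oplus>y\<in>supp a. \<zero>)"
      using a by (intro finsum_cong') (auto simp: coeff_closed)
    then have "(a \<otimes>\<^bsub>RG\<^esub> b) x = \<zero>"
      using mult_eq[OF a b _ order_refl xc] a by (simp add: carrier_RG)
    then show False using x by (simp add: supp_def)
  qed
  then obtain y where y: "y \<in> supp a" "inv\<^bsub>G\<^esub> y \<otimes>\<^bsub>G\<^esub> x \<in> supp b" by (auto simp: supp_def)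
  moreover have "x = y \<otimes>\<^bsub>G\<^esub> (inv\<^bsub>G\<^esub> y \<otimes>\<^bsub>G\<^esub> x)"
    using y(1) a xc by (auto simp: carrier_RG simp flip: G.m_assoc)
  ultimately show "x \<in> supp a <#>\<^bsub>G\<^esub> supp b" by (auto simp: set_mult_def)
qed

lemma finite_supp_set_mult:
  assumes "a \<in> carrier RG" "b \<in> carrier RG"
  shows "finite (supp a <#>\<^bsub>G\<^esub> supp b)"
  using assms by (auto simp: set_mult_def carrier_RG)

lemma supp_set_mult_carrier:
  assumes "a \<in> carrier RG" "b \<in> carrier RG"
  shows "supp a <#>\<^bsub>G\<^esub> supp b \<subseteq> carrier G"
  using assms by (auto simp: set_mult_def carrier_RG)

lemma mult_closed:
  assumes a: "a \<in> carrier RG" and b: "b \<in> carrier RG"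
  shows "a \<otimes>\<^bsub>RG\<^esub> b \<in> carrier RG"
  unfolding carrier_RG
proof (intro conjI ballI)
  show "(a \<otimes>\<^bsub>RG\<^esub> b) x \<in> carrier R" if "x \<in> carrier G" for x
    using that a b mult_eq[OF a b _ order_refl that]
    by (auto simp: carrier_RG coeff_closed intro!: finsum_closed)
  show "supp (a \<otimes>\<^bsub>RG\<^esub> b) \<subseteq> carrier G"
    using supp_mult_subset[OF a b] supp_set_mult_carrier[OF a b] by blast
  show "finite (supp (a \<otimes>\<^bsub>RG\<^esub> b))"
    using supp_mult_subset[OF a b] finite_supp_set_mult[OF a b] finite_subset by blast
qed

lemma supp_of_group: "supp (of_group g) \<subseteq> {g}"
  by (auto simp: supp_def group_ring_of_def)

lemma of_group_closed:
  assumes "g \<in> carrier G" shows "of_group g \<in> carrier RG"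
  using assms supp_of_group[of g] finite_subset[OF supp_of_group, of g]
  by (auto simp: carrier_RG group_ring_of_def)

lemma of_group_mult:
  assumes g: "g \<in> carrier G" and a: "a \<in> carrier RG" and x: "x \<in> carrier G"
  shows "(of_group g \<otimes>\<^bsub>RG\<^esub> a) x = a (inv\<^bsub>G\<^esub> g \<otimes>\<^bsub>G\<^esub> x)"
  using mult_eq[OF of_group_closed[OF g] a _ supp_of_group x] a g x
  by (simp add: group_ring_of_def coeff_closed)

lemma mult_of_group:
  assumes g: "g \<in> carrier G" and a: "a \<in> carrier RG" and x: "x \<in> carrier G"
  shows "(a \<otimes>\<^bsub>RG\<^esub> of_group g) x = a (x \<otimes>\<^bsub>G\<^esub> inv\<^bsub>G\<^esub> g)"
proof -
  let ?z = "x \<otimes>\<^bsub>G\<^esub> inv\<^bsub>G\<^esub> g"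
  let ?S = "insert ?z (supp a)"
  have S: "finite ?S" "supp a \<subseteq> ?S" "?S \<subseteq> carrier G" using a g x by (auto simp: carrier_RG)
  have iff: "inv\<^bsub>G\<^esub> y \<otimes>\<^bsub>G\<^esub> x = g \<longleftrightarrow> ?z = y" if "y \<in> carrier G" for y
    using that g x by (metis G.inv_solve_left G.inv_solve_right)
  have "(a \<otimes>\<^bsub>RG\<^esub> of_group g) x = (\<Oplus>y\<in>?S. a y \<otimes> of_group g (inv\<^bsub>G\<^esub> y \<otimes>\<^bsub>G\<^esub> x))"
    using S by (intro mult_eq a of_group_closed g x)
  also have "\<dots> = (\<Oplus>y\<in>?S. if ?z = y then a y else \<zero>)"
  proof (rule finsum_cong'[OF refl])
    fix y assume "y \<in> ?S"
    then have "y \<in> carrier G" using S(3) by blast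
    then show "a y \<otimes> of_group g (inv\<^bsub>G\<^esub> y \<otimes>\<^bsub>G\<^esub> x) = (if ?z = y then a y else \<zero>)"
      using a iff[of y] by (simp add: group_ring_of_def coeff_closed)
  qed (use a coeff_closed in auto)
  also have "\<dots> = a ?z"
    using S(1) a by (intro finsum_singleton) (auto simp: coeff_closed)
  finally show ?thesis .
qed

text \<open>
  Both the associativity of the product and the multiplicativity of the augmentation come down to
  this change of summation variable.
\<close>

lemma sum_translate:
  assumes y: "y \<in> carrier G" and S: "finite S" "(\<lambda>z. y \<otimes>\<^bsub>G\<^esub> z) ` T \<subseteq> S" "S \<subseteq> carrier G"
    and T: "T \<subseteq> carrier G"
    and F: "\<And>z. z \<in> carrier G \<Longrightarrow> F z \<in> carrier R"
    and F0: "\<And>z. z \<in> carrier G \<Longrightarrow> z \<notin> T \<Longrightarrow> F z = \<zero>"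
  shows "(\<Oplus>w\<in>S. F (inv\<^bsub>G\<^esub> y \<otimes>\<^bsub>G\<^esub> w)) = (\<Oplus>z\<in>T. F z)"
proof -
  have cancel: "inv\<^bsub>G\<^esub> y \<otimes>\<^bsub>G\<^esub> (y \<otimes>\<^bsub>G\<^esub> z) = z" "y \<otimes>\<^bsub>G\<^esub> (inv\<^bsub>G\<^esub> y \<otimes>\<^bsub>G\<^esub> z) = z" if "z \<in> carrier G" for z
    using that y by (simp_all flip: G.m_assoc)
  have "(\<Oplus>w\<in>S. F (inv\<^bsub>G\<^esub> y \<otimes>\<^bsub>G\<^esub> w)) = (\<Oplus>w\<in>(\<lambda>z. y \<otimes>\<^bsub>G\<^esub> z) ` T. F (inv\<^bsub>G\<^esub> y \<otimes>\<^bsub>G\<^esub> w))"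
  proof (rule add.finprod_mono_neutral_cong_right[OF S(1,2)])
    fix w assume w: "w \<in> S - (\<lambda>z. y \<otimes>\<^bsub>G\<^esub> z) ` T"
    then have wc: "w \<in> carrier G" using S(3) by blast
    have "inv\<^bsub>G\<^esub> y \<otimes>\<^bsub>G\<^esub> w \<notin> T"
    proof
      assume "inv\<^bsub>G\<^esub> y \<otimes>\<^bsub>G\<^esub> w \<in> T"
      then have "y \<otimes>\<^bsub>G\<^esub> (inv\<^bsub>G\<^esub> y \<otimes>\<^bsub>G\<^esub> w) \<in> (\<lambda>z. y \<otimes>\<^bsub>G\<^esub> z) ` T" by (rule imageI)
      then show False using w wc cancel by simp
    qed
    then show "F (inv\<^bsub>G\<^esub> y \<otimes>\<^bsub>G\<^esub> w) = \<zero>" using F0 wc y by simp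
  qed (use y S F in auto)
  also have "\<dots> = (\<Oplus>z\<in>T. F (inv\<^bsub>G\<^esub> y \<otimes>\<^bsub>G\<^esub> (y \<otimes>\<^bsub>G\<^esub> z)))"
  proof (rule finsum_reindex)
    show "inj_on (\<lambda>z. y \<otimes>\<^bsub>G\<^esub> z) T" using T y by (intro inj_onI) (simp add: subset_iff)
  qed (use y T F in auto)
  also have "\<dots> = (\<Oplus>z\<in>T. F z)"
    using T F cancel by (intro finsum_cong') (auto simp: subset_iff)
  finally show ?thesis .
qed

lemma sum_mult_translate:
  assumes a: "a \<in> carrier RG" and b: "b \<in> carrier RG" and y: "y \<in> supp a"
    and F: "\<And>z. z \<in> carrier G \<Longrightarrow> F z \<in> carrier R"
    and F0: "\<And>z. z \<in> carrier G \<Longrightarrow> z \<notin> supp b \<Longrightarrow> F z = \<zero>"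
  shows "(\<Oplus>w\<in>supp a <#>\<^bsub>G\<^esub> supp b. F (inv\<^bsub>G\<^esub> y \<otimes>\<^bsub>G\<^esub> w)) = (\<Oplus>z\<in>supp b. F z)"
proof (rule sum_translate[OF _ finite_supp_set_mult[OF a b] _ supp_set_mult_carrier[OF a b] _ F F0])
  show "(\<lambda>z. y \<otimes>\<^bsub>G\<^esub> z) ` supp b \<subseteq> supp a <#>\<^bsub>G\<^esub> supp b"
    using y by (auto simp: set_mult_def)
qed (use a b y in \<open>auto simp: carrier_RG\<close>)

lemma mult_assoc:
  assumes a: "a \<in> carrier RG" and b: "b \<in> carrier RG" and c: "c \<in> carrier RG"
  shows "a \<otimes>\<^bsub>RG\<^esub> b \<otimes>\<^bsub>RG\<^esub> c = a \<otimes>\<^bsub>RG\<^esub> (b \<otimes>\<^bsub>RG\<^esub> c)"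
proof
  fix x
  show "(a \<otimes>\<^bsub>RG\<^esub> b \<otimes>\<^bsub>RG\<^esub> c) x = (a \<otimes>\<^bsub>RG\<^esub> (b \<otimes>\<^bsub>RG\<^esub> c)) x"
  proof (cases "x \<in> carrier G")
    case False
    then show ?thesis by (simp add: mult_outside)
  next
    case x: True
    let ?S = "supp a <#>\<^bsub>G\<^esub> supp b"
    have S: "finite ?S" "?S \<subseteq> carrier G"
      using finite_supp_set_mult[OF a b] supp_set_mult_carrier[OF a b] by auto
    have A: "finite (supp a)" "supp a \<subseteq> carrier G" using a by (auto simp: carrier_RG)
    note cl = coeff_closed[OF a] coeff_closed[OF b] coeff_closed[OF c]
    have inner: "(\<Oplus>w\<in>?S. b (inv\<^bsub>G\<^esub> y \<otimes>\<^bsub>G\<^esub> w) \<otimes> c (inv\<^bsub>G\<^esub> w \<otimes>\<^bsub>G\<^esub> x)) =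
        (b \<otimes>\<^bsub>RG\<^esub> c) (inv\<^bsub>G\<^esub> y \<otimes>\<^bsub>G\<^esub> x)" if y: "y \<in> supp a" for y
    proof -
      have yc: "y \<in> carrier G" using y A by blast
      have shift: "inv\<^bsub>G\<^esub> (inv\<^bsub>G\<^esub> y \<otimes>\<^bsub>G\<^esub> w) \<otimes>\<^bsub>G\<^esub> (inv\<^bsub>G\<^esub> y \<otimes>\<^bsub>G\<^esub> x) = inv\<^bsub>G\<^esub> w \<otimes>\<^bsub>G\<^esub> x"
        if w: "w \<in> carrier G" for w
      proof -
        have "y \<otimes>\<^bsub>G\<^esub> (inv\<^bsub>G\<^esub> y \<otimes>\<^bsub>G\<^esub> x) = x" using yc x by (simp flip: G.m_assoc)
        then show ?thesis using yc x w by (simp add: G.inv_mult_group G.m_assoc)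
      qed
      have "(\<Oplus>w\<in>?S. b (inv\<^bsub>G\<^esub> y \<otimes>\<^bsub>G\<^esub> w) \<otimes> c (inv\<^bsub>G\<^esub> w \<otimes>\<^bsub>G\<^esub> x)) =
        (\<Oplus>w\<in>?S. b (inv\<^bsub>G\<^esub> y \<otimes>\<^bsub>G\<^esub> w) \<otimes> c (inv\<^bsub>G\<^esub> (inv\<^bsub>G\<^esub> y \<otimes>\<^bsub>G\<^esub> w) \<otimes>\<^bsub>G\<^esub> (inv\<^bsub>G\<^esub> y \<otimes>\<^bsub>G\<^esub> x)))"
        using S(2) shift cl by (intro finsum_cong') (auto simp: subset_iff)
      also have "\<dots> = (\<Oplus>z\<in>supp b. b z \<otimes> c (inv\<^bsub>G\<^esub> z \<otimes>\<^bsub>G\<^esub> (inv\<^bsub>G\<^esub> y \<otimes>\<^bsub>G\<^esub> x)))"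
        by (rule sum_mult_translate[OF a b y]) (use cl in \<open>auto simp: supp_def\<close>)
      also have "\<dots> = (b \<otimes>\<^bsub>RG\<^esub> c) (inv\<^bsub>G\<^esub> y \<otimes>\<^bsub>G\<^esub> x)"
        using b yc x by (intro mult_eq[symmetric] b c) (auto simp: carrier_RG)
      finally show ?thesis .
    qed
    \<comment> \<open>Expand the product over \<open>w\<close> and then \<open>y\<close>, exchange the sums, and recognize the inner one by translation.\<close>
    have "(a \<otimes>\<^bsub>RG\<^esub> b \<otimes>\<^bsub>RG\<^esub> c) x = (\<Oplus>w\<in>?S. (a \<otimes>\<^bsub>RG\<^esub> b) w \<otimes> c (inv\<^bsub>G\<^esub> w \<otimes>\<^bsub>G\<^esub> x))"
      by (intro mult_eq mult_closed a b c S supp_mult_subset x)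
    also have "\<dots> = (\<Oplus>w\<in>?S. \<Oplus>y\<in>supp a. a y \<otimes> (b (inv\<^bsub>G\<^esub> y \<otimes>\<^bsub>G\<^esub> w) \<otimes> c (inv\<^bsub>G\<^esub> w \<otimes>\<^bsub>G\<^esub> x)))"
    proof (rule finsum_cong'[OF refl])
      fix w assume "w \<in> ?S"
      then have w: "w \<in> carrier G" using S by blast
      have "(a \<otimes>\<^bsub>RG\<^esub> b) w \<otimes> c (inv\<^bsub>G\<^esub> w \<otimes>\<^bsub>G\<^esub> x) =
          (\<Oplus>y\<in>supp a. a y \<otimes> b (inv\<^bsub>G\<^esub> y \<otimes>\<^bsub>G\<^esub> w)) \<otimes> c (inv\<^bsub>G\<^esub> w \<otimes>\<^bsub>G\<^esub> x)"
        using mult_eq[OF a b A(1) order_refl w] by simp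
      also have "\<dots> = (\<Oplus>y\<in>supp a. a y \<otimes> b (inv\<^bsub>G\<^esub> y \<otimes>\<^bsub>G\<^esub> w) \<otimes> c (inv\<^bsub>G\<^esub> w \<otimes>\<^bsub>G\<^esub> x))"
        using A cl by (intro finsum_ldistr) auto
      also have "\<dots> = (\<Oplus>y\<in>supp a. a y \<otimes> (b (inv\<^bsub>G\<^esub> y \<otimes>\<^bsub>G\<^esub> w) \<otimes> c (inv\<^bsub>G\<^esub> w \<otimes>\<^bsub>G\<^esub> x)))"
        using cl by (intro finsum_cong') (auto simp: m_assoc)
      finally show "(a \<otimes>\<^bsub>RG\<^esub> b) w \<otimes> c (inv\<^bsub>G\<^esub> w \<otimes>\<^bsub>G\<^esub> x) = \<dots>" .
    qed (use cl in \<open>auto intro!: finsum_closed\<close>)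
    also have "\<dots> = (\<Oplus>y\<in>supp a. \<Oplus>w\<in>?S. a y \<otimes> (b (inv\<^bsub>G\<^esub> y \<otimes>\<^bsub>G\<^esub> w) \<otimes> c (inv\<^bsub>G\<^esub> w \<otimes>\<^bsub>G\<^esub> x)))"
      using cl A S by (intro finsum_swap) auto
    also have "\<dots> = (\<Oplus>y\<in>supp a. a y \<otimes> (b \<otimes>\<^bsub>RG\<^esub> c) (inv\<^bsub>G\<^esub> y \<otimes>\<^bsub>G\<^esub> x))"
    proof (rule finsum_cong'[OF refl])
      fix y assume y: "y \<in> supp a"
      show "(\<Oplus>w\<in>?S. a y \<otimes> (b (inv\<^bsub>G\<^esub> y \<otimes>\<^bsub>G\<^esub> w) \<otimes> c (inv\<^bsub>G\<^esub> w \<otimes>\<^bsub>G\<^esub> x))) =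
          a y \<otimes> (b \<otimes>\<^bsub>RG\<^esub> c) (inv\<^bsub>G\<^esub> y \<otimes>\<^bsub>G\<^esub> x)"
        using inner[OF y, symmetric] S cl by (simp add: finsum_rdistr)
    qed (use cl coeff_closed[OF mult_closed[OF b c]] in auto)
    also have "\<dots> = (a \<otimes>\<^bsub>RG\<^esub> (b \<otimes>\<^bsub>RG\<^esub> c)) x"
      by (intro mult_eq[symmetric] a mult_closed b c A order_refl x)
    finally show ?thesis .
  qed
qed

lemma monoid_RG: "Group.monoid RG"
proof (rule monoidI)
  show "\<one>\<^bsub>RG\<^esub> \<in> carrier RG" unfolding one_RG by (rule of_group_closed) simp
  fix a assume a: "a \<in> carrier RG"
  show "\<one>\<^bsub>RG\<^esub> \<otimes>\<^bsub>RG\<^esub> a = a"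
  proof
    fix x show "(\<one>\<^bsub>RG\<^esub> \<otimes>\<^bsub>RG\<^esub> a) x = a x"
    proof (cases "x \<in> carrier G")
      case True
      then show ?thesis using a unfolding one_RG by (simp add: of_group_mult)
    next
      case False
      then show ?thesis using a by (simp add: mult_outside coeff_outside)
    qed
  qed
  show "a \<otimes>\<^bsub>RG\<^esub> \<one>\<^bsub>RG\<^esub> = a"
  proof
    fix x show "(a \<otimes>\<^bsub>RG\<^esub> \<one>\<^bsub>RG\<^esub>) x = a x"
    proof (cases "x \<in> carrier G")
      case True
      then show ?thesis using a unfolding one_RG by (simp add: mult_of_group)
    next
      case False
      then show ?thesis using a by (simp add: mult_outside coeff_outside)
    qed
  qed
qed (auto intro: mult_closed mult_assoc)

lemma of_group_hom:
  assumes g: "g \<in> carrier G" and h: "h \<in> carrier G"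
  shows "of_group (g \<otimes>\<^bsub>G\<^esub> h) = of_group g \<otimes>\<^bsub>RG\<^esub> of_group h"
proof
  fix x
  show "of_group (g \<otimes>\<^bsub>G\<^esub> h) x = (of_group g \<otimes>\<^bsub>RG\<^esub> of_group h) x"
  proof (cases "x \<in> carrier G")
    case x: True
    have "inv\<^bsub>G\<^esub> g \<otimes>\<^bsub>G\<^esub> x = h \<longleftrightarrow> x = g \<otimes>\<^bsub>G\<^esub> h"
      using x g h by (metis G.inv_solve_left)
    then have "of_group (g \<otimes>\<^bsub>G\<^esub> h) x = of_group h (inv\<^bsub>G\<^esub> g \<otimes>\<^bsub>G\<^esub> x)"
      by (simp add: group_ring_of_def)
    then show ?thesis using of_group_mult[OF g of_group_closed[OF h] x] by simp
  next
    case False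
    then have "x \<noteq> g \<otimes>\<^bsub>G\<^esub> h" using g h by auto
    then show ?thesis using False by (simp add: mult_outside group_ring_of_def)
  qed
qed

lemma of_group_Units:
  assumes g: "g \<in> carrier G" shows "of_group g \<in> Units RG"
proof -
  have "of_group (inv\<^bsub>G\<^esub> g) \<otimes>\<^bsub>RG\<^esub> of_group g = \<one>\<^bsub>RG\<^esub>" "of_group g \<otimes>\<^bsub>RG\<^esub> of_group (inv\<^bsub>G\<^esub> g) = \<one>\<^bsub>RG\<^esub>"
    using g by (simp_all add: one_RG flip: of_group_hom)
  then show ?thesis using g by (auto simp: Units_def of_group_closed)
qed

definition augmentation :: "('g \<Rightarrow> 'r) \<Rightarrow> 'r" where
  "augmentation a = (\<Oplus>x\<in>supp a. a x)"

lemma augmentation_closed: "a \<in> carrier RG \<Longrightarrow> augmentation a \<in> carrier R"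
  by (auto simp: augmentation_def coeff_closed intro!: finsum_closed)

lemma augmentation_eq:
  assumes "a \<in> carrier RG" "finite S" "supp a \<subseteq> S"
  shows "augmentation a = (\<Oplus>x\<in>S. a x)"
  unfolding augmentation_def using assms
  by (intro add.finprod_mono_neutral_cong_left) (auto simp: supp_def coeff_closed)

lemma augmentation_mult:
  assumes a: "a \<in> carrier RG" and b: "b \<in> carrier RG"
  shows "augmentation (a \<otimes>\<^bsub>RG\<^esub> b) = augmentation a \<otimes> augmentation b"
proof -
  let ?S = "supp a <#>\<^bsub>G\<^esub> supp b"
  have S: "finite ?S" "?S \<subseteq> carrier G"
    using finite_supp_set_mult[OF a b] supp_set_mult_carrier[OF a b] by auto
  have A: "finite (supp a)" "supp a \<subseteq> carrier G" using a by (auto simp: carrier_RG)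
  note cl = coeff_closed[OF a] coeff_closed[OF b]
  have "augmentation (a \<otimes>\<^bsub>RG\<^esub> b) = (\<Oplus>w\<in>?S. (a \<otimes>\<^bsub>RG\<^esub> b) w)"
    by (intro augmentation_eq mult_closed a b S supp_mult_subset)
  also have "\<dots> = (\<Oplus>w\<in>?S. \<Oplus>y\<in>supp a. a y \<otimes> b (inv\<^bsub>G\<^esub> y \<otimes>\<^bsub>G\<^esub> w))"
    using S cl mult_eq[OF a b A(1) order_refl]
    by (intro finsum_cong') (auto intro!: finsum_closed)
  also have "\<dots> = (\<Oplus>y\<in>supp a. \<Oplus>w\<in>?S. a y \<otimes> b (inv\<^bsub>G\<^esub> y \<otimes>\<^bsub>G\<^esub> w))"
    using cl A S by (intro finsum_swap) auto
  also have "\<dots> = (\<Oplus>y\<in>supp a. a y \<otimes> augmentation b)"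
  proof (rule finsum_cong'[OF refl])
    fix y assume y: "y \<in> supp a"
    have "(\<Oplus>w\<in>?S. b (inv\<^bsub>G\<^esub> y \<otimes>\<^bsub>G\<^esub> w)) = augmentation b"
      unfolding augmentation_def
      by (rule sum_mult_translate[OF a b y]) (use cl in \<open>auto simp: supp_def\<close>)
    then show "(\<Oplus>w\<in>?S. a y \<otimes> b (inv\<^bsub>G\<^esub> y \<otimes>\<^bsub>G\<^esub> w)) = a y \<otimes> augmentation b"
      using S cl by (simp flip: finsum_rdistr)
  qed (use cl augmentation_closed[OF b] in auto)
  also have "\<dots> = augmentation a \<otimes> augmentation b"
    unfolding augmentation_def[of a] using A cl augmentation_closed[OF b]
    by (intro finsum_ldistr[symmetric]) auto
  finally show ?thesis .
qed

lemma augmentation_of_group: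
  assumes "g \<in> carrier G" shows "augmentation (of_group g) = \<one>"
  using augmentation_eq[OF of_group_closed[OF assms] _ supp_of_group]
  by (simp add: group_ring_of_def)

lemma augmentation_Units:
  assumes "u \<in> Units RG" shows "augmentation u \<in> Units R"
proof -
  obtain v where u: "u \<in> carrier RG" and v: "v \<in> carrier RG"
    and "v \<otimes>\<^bsub>RG\<^esub> u = \<one>\<^bsub>RG\<^esub>" "u \<otimes>\<^bsub>RG\<^esub> v = \<one>\<^bsub>RG\<^esub>"
    using assms by (auto simp: Units_def)
  then have "augmentation v \<otimes> augmentation u = \<one>" "augmentation u \<otimes> augmentation v = \<one>"
    by (simp_all add: one_RG augmentation_of_group flip: augmentation_mult)
  then show ?thesis using u v augmentation_closed by (auto simp: Units_def)
qed

end

section \<open>Fixed points of actions of p-groups\<close>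

text \<open>
  If another prime divided the order, a Sylow subgroup would contain a nontrivial element whose
  order is coprime to \<open>p\<close>.
\<close>

lemma (in group) order_prime_power:
  assumes fin: "finite (carrier G)" and p: "Factorial_Ring.prime (p::nat)"
    and tors: "carrier G \<subseteq> power_torsion G p"
  shows "\<exists>e. order G = p ^ e"
proof -
  have "order G > 0" using fin order_gt_0_iff_finite by blast
  moreover have "\<not> p dvd 1" using p not_prime_1 by auto
  ultimately obtain m where m: "order G = p ^ multiplicity p (order G) * m" "\<not> p dvd m"
    using multiplicity_decompose'[of "order G" p] p by auto
  have "m = 1"
  proof (rule ccontr)
    assume "m \<noteq> 1"
    then obtain q where q: "Factorial_Ring.prime q" "q dvd m" using prime_factor_nat by blast
    then have "coprime q p" using m(2) p primes_coprime by blast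
    obtain r where "order G = q ^ 1 * r"
      using q(2) m(1) by (metis dvd_def dvd_mult power_one_right)
    then obtain K where K: "subgroup K G" "card K = q"
      using sylow_thm[OF q(1) is_group _ fin, of 1 r] by auto
    interpret K: group "G\<lparr>carrier := K\<rparr>" using K(1) by (rule subgroup_imp_group)
    have "K \<noteq> {\<one>}" using K(2) q(1) not_prime_1 by auto
    then obtain x where x: "x \<in> K" "x \<noteq> \<one>" using subgroup.one_closed[OF K(1)] by blast
    have xc: "x \<in> carrier G" using x(1) subgroup.subset[OF K(1)] by blast
    have "x [^]\<^bsub>G\<lparr>carrier := K\<rparr>\<^esub> q = \<one>"
      using K.pow_order_eq_1[of x] x(1) K(2) by (simp add: order_def)
    then have "x [^] q = \<one>" by (simp flip: nat_pow_consistent)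
    moreover obtain k where "x [^] (p ^ k) = \<one>"
      using tors xc unfolding power_torsion_def by blast
    moreover have "coprime q (p ^ k)" using \<open>coprime q p\<close> by simp
    ultimately have "x = \<one>" using coprime_pow_eq_one[OF xc] by blast
    then show False using x(2) by contradiction
  qed
  then show ?thesis using m(1) by auto
qed

lemma finite_BijGroup:
  assumes "finite E" shows "finite (carrier (BijGroup E))"
proof (rule finite_subset)
  show "carrier (BijGroup E) \<subseteq> (\<Pi>\<^sub>E x\<in>E. E)"
    by (auto simp: BijGroup_def Bij_def PiE_def bij_betw_def)
qed (use assms in \<open>auto intro: finite_PiE\<close>)

text \<open>
  The acting group may be infinite, so the orbit-stabilizer theorem is applied to its image among
  the permutations of \<open>E\<close>. The image is a finite \<open>p\<close>-group with the same orbits.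
\<close>

lemma (in group_action) card_orbit_prime_power:
  assumes E: "finite E" and p: "Factorial_Ring.prime (p::nat)"
    and tors: "carrier G \<subseteq> power_torsion G p" and x: "x \<in> E"
  shows "\<exists>e. card (orbit G \<phi> x) = p ^ e"
proof -
  interpret phi: group_hom G "BijGroup E" \<phi> by (rule group_hom)
  define I where "I = (BijGroup E)\<lparr>carrier := \<phi> ` carrier G\<rparr>"
  have sub: "subgroup (\<phi> ` carrier G) (BijGroup E)" by (rule phi.img_is_subgroup)
  interpret I: group I unfolding I_def by (rule phi.H.subgroup_imp_group[OF sub])
  have finI: "finite (carrier I)"
    using finite_BijGroup[OF E] subgroup.subset[OF sub] finite_subset by (auto simp: I_def)
  have "carrier I \<subseteq> power_torsion I p"
  proof
    fix f assume "f \<in> carrier I"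
    then obtain g where g: "g \<in> carrier G" "f = \<phi> g" by (auto simp: I_def)
    obtain k where "g [^] (p ^ k) = \<one>" using tors g(1) unfolding power_torsion_def by blast
    then have "f [^]\<^bsub>BijGroup E\<^esub> (p ^ k) = \<one>\<^bsub>BijGroup E\<^esub>"
      using g phi.hom_nat_pow[of g "p ^ k"] by simp
    then have "f [^]\<^bsub>I\<^esub> (p ^ k) = \<one>\<^bsub>I\<^esub>"
      unfolding I_def by (simp flip: phi.H.nat_pow_consistent)
    then show "f \<in> power_torsion I p"
      using \<open>f \<in> carrier I\<close> unfolding power_torsion_def by blast
  qed
  then obtain e where e: "order I = p ^ e"
    using I.order_prime_power[OF finI p] by blast
  interpret A: group_action I E "\<lambda>f. f"
  proof
    show "(\<lambda>f. f) \<in> hom I (BijGroup E)"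
      using subgroup.subset[OF sub] by (auto simp: I_def hom_def)
  qed
  have "orbit I (\<lambda>f. f) x = orbit G \<phi> x"
    by (auto simp: orbit_def I_def)
  then have "card (orbit G \<phi> x) dvd p ^ e"
    using A.orbit_stabilizer_theorem[OF x] e by (metis dvd_triv_left)
  then show ?thesis using p divides_primepow_nat by blast
qed

text \<open>
  Every orbit has \<open>p\<close>-power size different from \<open>1\<close>, so its contribution to the sum, a multiple
  of one value by the orbit size, is a multiple of \<open>p\<close>.
\<close>

lemma (in cring) finsum_invariant_no_fixed_point:
  assumes act: "group_action P E \<phi>" and E: "finite E" and p: "Factorial_Ring.prime (p::nat)"
    and tors: "carrier P \<subseteq> power_torsion P p"
    and nofix: "\<And>x. x \<in> E \<Longrightarrow> \<exists>g\<in>carrier P. \<phi> g x \<noteq> x"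
    and f: "\<And>x. x \<in> E \<Longrightarrow> f x \<in> carrier R"
    and inv: "\<And>g x. g \<in> carrier P \<Longrightarrow> x \<in> E \<Longrightarrow> f (\<phi> g x) = f x"
  shows "\<exists>r\<in>carrier R. (\<Oplus>x\<in>E. f x) = add_pow R p \<one> \<otimes> r"
proof -
  interpret A: group_action P E \<phi> by (rule act)
  have one_orbit: "\<exists>r\<in>carrier R. (\<Oplus>x\<in>B. f x) = add_pow R p \<one> \<otimes> r" if B: "B \<in> orbits P E \<phi>" for B
  proof -
    obtain x where x: "x \<in> E" "B = orbit P \<phi> x" using B by (auto simp: orbits_def)
    have BE: "B \<subseteq> E" using B A.orbits_coverture by blast
    obtain e where e: "card B = p ^ e"
      using A.card_orbit_prime_power[OF E p tors x(1)] x(2) by blast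
    have "e \<noteq> 0"
    proof
      assume "e = 0"
      then have "card B = 1" using e by simp
      then obtain b where b: "B = {b}" by (auto simp: card_1_singleton_iff)
      have "x \<in> B" using A.orbit_refl[OF x(1)] x(2) by simp
      moreover have "\<phi> g x \<in> B" if "g \<in> carrier P" for g
        using that x(2) by (auto simp: orbit_def)
      ultimately show False using nofix[OF x(1)] b by auto
    qed
    then obtain e' where e': "e = Suc e'" using not0_implies_Suc by blast
    have const: "f y = f x" if "y \<in> B" for y
      using that x inv by (auto simp: orbit_def)
    have "(\<Oplus>y\<in>B. f y) = (\<Oplus>y\<in>B. f x)"
      using const f[OF x(1)] by (intro finsum_cong') auto
    also have "\<dots> = add_pow R (card B) (f x)" using f[OF x(1)] by (rule add.finprod_const)
    also have "\<dots> = add_pow R p (add_pow R (p ^ e') (f x))"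
      using f[OF x(1)] unfolding e e' by (simp add: add.nat_pow_pow mult.commute)
    also have "\<dots> = add_pow R p \<one> \<otimes> add_pow R (p ^ e') (f x)"
      using f[OF x(1)] by (simp add: add_pow_ldistr)
    finally show ?thesis using f[OF x(1)] by blast
  qed
  then obtain r where r: "\<And>B. B \<in> orbits P E \<phi> \<Longrightarrow> r B \<in> carrier R"
    "\<And>B. B \<in> orbits P E \<phi> \<Longrightarrow> (\<Oplus>x\<in>B. f x) = add_pow R p \<one> \<otimes> r B"
    by metis
  have fin: "finite (orbits P E \<phi>)"
    using E A.orbits_coverture by (metis finite_UnionD)
  have "(\<Oplus>x\<in>\<Union>((\<lambda>B. B) ` orbits P E \<phi>). f x) = (\<Oplus>B\<in>orbits P E \<phi>. \<Oplus>x\<in>B. f x)"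
  proof (rule add.finprod_UN_disjoint[OF fin])
    show "finite B" if "B \<in> orbits P E \<phi>" for B
      using that E A.orbits_coverture by (metis Union_upper finite_subset)
    show "pairwise (\<lambda>i j. disjnt i j) (orbits P E \<phi>)"
      using A.disjoint_union by (auto simp: pairwise_def disjnt_def)
    show "f x \<in> carrier R" if "B \<in> orbits P E \<phi>" "x \<in> B" for B x
      using that f A.orbits_coverture by blast
  qed
  also have "(\<Oplus>B\<in>orbits P E \<phi>. \<Oplus>x\<in>B. f x) = (\<Oplus>B\<in>orbits P E \<phi>. add_pow R p \<one> \<otimes> r B)"
    using r by (intro finsum_cong') auto
  also have "\<dots> = add_pow R p \<one> \<otimes> (\<Oplus>B\<in>orbits P E \<phi>. r B)"
    using fin r(1) by (intro finsum_rdistr[symmetric]) auto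
  finally show ?thesis using r(1) A.orbits_coverture by (auto intro!: bexI finsum_closed)
qed

text \<open>
  The hypothesis on \<open>u\<close> says that its coefficients are invariant under the action
  \<open>g \<mapsto> h g s(h)\<^sup>-\<^sup>1\<close> of \<open>P\<close> on its support. The \<open>g\<close> sought is a fixed point of this action;
  without one, \<open>p\<close> would divide the augmentation of \<open>u\<close>, which is a unit.
\<close>

lemma (in group_algebra) coleman:
  assumes P: "subgroup P G" and tors: "P \<subseteq> power_torsion G p" and p: "Factorial_Ring.prime (p::nat)"
    and s: "\<And>h. h \<in> P \<Longrightarrow> s h \<in> carrier G"
    and s_hom: "\<And>h k. h \<in> P \<Longrightarrow> k \<in> P \<Longrightarrow> s (h \<otimes>\<^bsub>G\<^esub> k) = s h \<otimes>\<^bsub>G\<^esub> s k"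
    and u: "u \<in> carrier RG" and aug: "augmentation u \<in> Units R"
    and conj: "\<And>h. h \<in> P \<Longrightarrow> of_group h \<otimes>\<^bsub>RG\<^esub> u = u \<otimes>\<^bsub>RG\<^esub> of_group (s h)"
    and nonunit: "add_pow R p \<one> \<notin> Units R"
  shows "\<exists>g\<in>supp u. \<forall>h\<in>P. h \<otimes>\<^bsub>G\<^esub> g = g \<otimes>\<^bsub>G\<^esub> s h"
proof (rule ccontr)
  assume neg: "\<not> ?thesis"
  let ?E = "supp u" and ?P = "G\<lparr>carrier := P\<rparr>"
  let ?act = "\<lambda>h. \<lambda>g\<in>supp u. h \<otimes>\<^bsub>G\<^esub> g \<otimes>\<^bsub>G\<^esub> inv\<^bsub>G\<^esub> (s h)"
  have E: "finite ?E" "?E \<subseteq> carrier G" using u by (auto simp: carrier_RG)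
  have Pc: "h \<in> carrier G" if "h \<in> P" for h using that P subgroup.subset by blast
  have coeff: "u (h \<otimes>\<^bsub>G\<^esub> g \<otimes>\<^bsub>G\<^esub> inv\<^bsub>G\<^esub> (s h)) = u g" if h: "h \<in> P" and g: "g \<in> carrier G" for h g
  proof -
    have "u (h \<otimes>\<^bsub>G\<^esub> g \<otimes>\<^bsub>G\<^esub> inv\<^bsub>G\<^esub> (s h)) = (u \<otimes>\<^bsub>RG\<^esub> of_group (s h)) (h \<otimes>\<^bsub>G\<^esub> g)"
      using s[OF h] Pc[OF h] g u by (simp add: mult_of_group)
    also have "\<dots> = (of_group h \<otimes>\<^bsub>RG\<^esub> u) (h \<otimes>\<^bsub>G\<^esub> g)" by (simp add: conj[OF h])
    also have "\<dots> = u (inv\<^bsub>G\<^esub> h \<otimes>\<^bsub>G\<^esub> (h \<otimes>\<^bsub>G\<^esub> g))"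
      using Pc[OF h] g u by (simp add: of_group_mult)
    also have "inv\<^bsub>G\<^esub> h \<otimes>\<^bsub>G\<^esub> (h \<otimes>\<^bsub>G\<^esub> g) = g" using Pc[OF h] g by (simp flip: G.m_assoc)
    finally show ?thesis .
  qed
  have maps: "h \<otimes>\<^bsub>G\<^esub> g \<otimes>\<^bsub>G\<^esub> inv\<^bsub>G\<^esub> (s h) \<in> ?E" if "h \<in> P" "g \<in> ?E" for h g
    using coeff[OF that(1)] that(2) E(2) by (auto simp: supp_def)
  have bij: "?act h \<in> Bij ?E" if h: "h \<in> P" for h
  proof -
    have inj: "inj_on (?act h) ?E"
    proof (rule inj_onI)
      fix x y assume "x \<in> ?E" "y \<in> ?E" "?act h x = ?act h y"
      moreover then have "x \<in> carrier G" "y \<in> carrier G" using E(2) by auto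
      ultimately show "x = y" using Pc[OF h] s[OF h] by simp
    qed
    moreover have "?act h ` ?E \<subseteq> ?E" using maps[OF h] by auto
    ultimately have "bij_betw (?act h) ?E ?E"
      using endo_inj_surj[OF E(1)] by (auto simp: bij_betw_def)
    then show ?thesis by (simp add: Bij_def)
  qed
  have act: "group_action ?P ?E ?act"
  proof (intro group_action.intro group_hom.intro group_hom_axioms.intro)
    show "group ?P" using P by (rule G.subgroup_imp_group)
    show "group (BijGroup ?E)" by (rule group_BijGroup)
    show "?act \<in> hom ?P (BijGroup ?E)"
    proof (rule homI)
      fix h assume "h \<in> carrier ?P"
      then show "?act h \<in> carrier (BijGroup ?E)" using bij by (simp add: BijGroup_def)
    next
      fix h k assume "h \<in> carrier ?P" "k \<in> carrier ?P"
      then have h: "h \<in> P" and k: "k \<in> P" by auto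
      have "?act (h \<otimes>\<^bsub>G\<^esub> k) = compose ?E (?act h) (?act k)"
      proof (rule extensionalityI[of _ ?E])
        fix g assume g: "g \<in> ?E"
        then have gc: "g \<in> carrier G" using E(2) by auto
        show "?act (h \<otimes>\<^bsub>G\<^esub> k) g = compose ?E (?act h) (?act k) g"
          using g gc maps[OF k g] Pc[OF h] Pc[OF k] s[OF h] s[OF k] s_hom[OF h k]
          by (simp add: compose_def G.inv_mult_group G.m_assoc)
      qed (auto simp: compose_def)
      then show "?act (h \<otimes>\<^bsub>?P\<^esub> k) = ?act h \<otimes>\<^bsub>BijGroup ?E\<^esub> ?act k"
        using bij[OF h] bij[OF k] by (simp add: BijGroup_def)
    qed
  qed
  have "\<exists>r\<in>carrier R. (\<Oplus>x\<in>?E. u x) = add_pow R p \<one> \<otimes> r"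
  proof (rule finsum_invariant_no_fixed_point[OF act E(1) p])
    show "carrier ?P \<subseteq> power_torsion ?P p"
      using tors by (auto simp: power_torsion_def simp flip: G.nat_pow_consistent)
    fix g assume g: "g \<in> ?E"
    then have gc: "g \<in> carrier G" using E(2) by auto
    show "u g \<in> carrier R" using u by (rule coeff_closed)
    obtain h where h: "h \<in> P" "h \<otimes>\<^bsub>G\<^esub> g \<noteq> g \<otimes>\<^bsub>G\<^esub> s h" using neg g by blast
    then have "?act h g \<noteq> g"
      using g gc Pc[OF h(1)] s[OF h(1)] G.inv_solve_right'[of g "h \<otimes>\<^bsub>G\<^esub> g" "s h"] by simp
    then show "\<exists>h\<in>carrier ?P. ?act h g \<noteq> g" using h(1) by auto
    show "u (?act k g) = u g" if "k \<in> carrier ?P" for k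
      using that g gc coeff by simp
  qed
  then obtain r where r: "r \<in> carrier R" "augmentation u = add_pow R p \<one> \<otimes> r"
    unfolding augmentation_def by blast
  then have "add_pow R p \<one> \<in> Units R"
    using aug unit_factor[of "add_pow R p \<one>" r] by simp
  then show False using nonunit by contradiction
qed

section \<open>Gluing conjugations over all primes\<close>

text \<open>
  The least \<open>k\<close> with \<open>x\<close> to the power \<open>p\<^sup>k\<close> trivial is positive, and stopping one step
  earlier gives the element. Adapted rings are defined through elements of order exactly \<open>p\<close>.
\<close>

lemma (in group) ex_ord_eq_prime:
  assumes p: "Factorial_Ring.prime (p::nat)" and x: "x \<in> power_torsion G p" "x \<noteq> \<one>"
  shows "\<exists>g\<in>carrier G. ord g = p"
proof -
  have xc: "x \<in> carrier G" using x(1) by (simp add: power_torsion_def)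
  have ex: "\<exists>k. x [^] (p ^ k) = \<one>" using x(1) unfolding power_torsion_def by blast
  define k where "k = (LEAST k. x [^] (p ^ k) = \<one>)"
  have k: "x [^] (p ^ k) = \<one>" unfolding k_def using ex by (rule LeastI_ex)
  have "k \<noteq> 0" using k x(2) xc by (metis nat_pow_eone power_0)
  then obtain j where j: "k = Suc j" using not0_implies_Suc by blast
  let ?y = "x [^] (p ^ j)"
  have "?y \<noteq> \<one>" using not_less_Least[of j "\<lambda>k. x [^] (p ^ k) = \<one>"] j unfolding k_def by simp
  moreover have "?y [^] p = \<one>" using k xc unfolding j by (simp add: nat_pow_pow mult.commute)
  then have "ord ?y dvd p" using pow_eq_id[of ?y p] xc by simp
  then have "ord ?y = 1 \<or> ord ?y = p" using p prime_nat_iff by blast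
  ultimately have "ord ?y = p" using ord_eq_1[of ?y] xc by auto
  then show ?thesis using xc by blast
qed

text \<open>
  Write \<open>n = q m\<close> with \<open>q\<close> a power of \<open>p\<close> and \<open>m\<close> prime to \<open>p\<close>; a Bezout relation
  \<open>1 = t m + s q\<close> gives the exponents. As both factors are powers of \<open>g\<close>, they stay in any
  subgroup that contains \<open>g\<close>.
\<close>

lemma (in group) split_prime_part:
  assumes g: "g \<in> carrier G" "g [^] (n::nat) = \<one>" "n > 0" and p: "Factorial_Ring.prime (p::nat)"
  obtains i j :: int and m :: nat where "g = g [^] i \<otimes> g [^] j" "g [^] i \<in> power_torsion G p"
    "(g [^] j) [^] m = \<one>" "\<not> p dvd m" "m dvd n"
proof -
  have "\<not> p dvd 1" using p not_prime_1 by auto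
  then obtain m where m: "n = p ^ multiplicity p n * m" "\<not> p dvd m"
    using multiplicity_decompose'[of n p] g(3) p by auto
  let ?q = "p ^ multiplicity p n"
  have "coprime ?q m" using m(2) p by (simp add: prime_imp_coprime)
  then have "coprime (int ?q) (int m)" unfolding coprime_int_iff .
  then obtain s t where st: "s * int ?q + t * int m = 1"
    using bezout_int[of "int ?q" "int m"] by auto
  have nm: "int n = int ?q * int m" using m(1) by (metis of_nat_mult)
  have trivial: "g [^] (int n * l) = \<one>" for l :: int
    using g by (simp add: int_pow_int flip: int_pow_pow)
  have "g = g [^] (t * int m + s * int ?q)" using st g(1) by (simp add: add.commute)
  then have 1: "g = g [^] (t * int m) \<otimes> g [^] (s * int ?q)"
    using g(1) by (simp add: int_pow_mult)
  have "(g [^] (t * int m)) [^] ?q = g [^] (int n * t)"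
    using g(1) nm by (simp add: int_pow_pow mult_ac flip: int_pow_int)
  then have 2: "g [^] (t * int m) \<in> power_torsion G p"
    using g(1) trivial unfolding power_torsion_def by auto
  have "(g [^] (s * int ?q)) [^] m = g [^] (int n * s)"
    using g(1) nm by (simp add: int_pow_pow mult_ac flip: int_pow_int)
  then have 3: "(g [^] (s * int ?q)) [^] m = \<one>" using trivial by simp
  have "m dvd n" by (subst m(1)) simp
  then show thesis using that 1 2 3 m(2) by blast
qed

lemma (in group) commute_with_power_torsion:
  assumes ln: "locally_nilpotent_group G" and x: "x \<in> power_torsion G p"
    and y: "y \<in> carrier G" "y [^] (m::nat) = \<one>" and pm: "coprime p m"
  shows "x \<otimes> y = y \<otimes> x"
proof -
  obtain k where k: "x [^] (p ^ k) = \<one>" using x unfolding power_torsion_def by blast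
  have "x \<in> carrier G" using x by (simp add: power_torsion_def)
  then show ?thesis using coprime_exponents_commute[OF ln _ k y] pm by simp
qed

lemma (in group) power_torsions_commute:
  assumes ln: "locally_nilpotent_group G" and x: "x \<in> power_torsion G p" and y: "y \<in> power_torsion G q"
    and pq: "coprime p q"
  shows "x \<otimes> y = y \<otimes> x"
proof -
  obtain k where k: "y [^] (q ^ k) = \<one>" using y unfolding power_torsion_def by blast
  have "y \<in> carrier G" using y by (simp add: power_torsion_def)
  then show ?thesis using commute_with_power_torsion[OF ln x _ k] pq by simp
qed

text \<open>
  The conjugator is the product, over \<open>p \<in> F\<close>, of the \<open>p\<close>-parts of the given conjugators. The
  second conjunct strengthens the induction: when a prime \<open>p\<close> is added, the conjugator found so
  far must commute with the \<open>p\<close>-elements, so that only the new factor acts on them.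
\<close>

lemma (in group) combine_local_conjugators:
  assumes ln: "locally_nilpotent_group G" and tg: "torsion_group G"
    and s: "\<And>n. s ` (H \<inter> power_torsion G n) \<subseteq> power_torsion G n"
    and F: "finite F" "\<And>p. p \<in> F \<Longrightarrow> Factorial_Ring.prime (p::nat)"
    and loc: "\<And>p. p \<in> F \<Longrightarrow> \<exists>c\<in>carrier G. \<forall>h\<in>H \<inter> power_torsion G p. h \<otimes> c = c \<otimes> s h"
  shows "\<exists>g\<in>carrier G. (\<forall>p\<in>F. \<forall>h\<in>H \<inter> power_torsion G p. h \<otimes> g = g \<otimes> s h) \<and>
      (\<forall>q. Factorial_Ring.prime q \<longrightarrow> q \<notin> F \<longrightarrow> (\<forall>x\<in>power_torsion G q. x \<otimes> g = g \<otimes> x))"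
  using F loc
proof (induction F rule: finite_induct)
  case empty
  show ?case by (rule bexI[of _ \<one>]) (auto simp: power_torsion_def)
next
  case (insert p F)
  have p: "Factorial_Ring.prime p" using insert.prems(1) by blast
  obtain g where g: "g \<in> carrier G"
    and gF: "\<And>q h. q \<in> F \<Longrightarrow> h \<in> H \<Longrightarrow> h \<in> power_torsion G q \<Longrightarrow> h \<otimes> g = g \<otimes> s h"
    and gC: "\<And>q x. Factorial_Ring.prime q \<Longrightarrow> q \<notin> F \<Longrightarrow> x \<in> power_torsion G q \<Longrightarrow> x \<otimes> g = g \<otimes> x"
    using insert.IH insert.prems by (auto simp: Ball_def)
  obtain c where c: "c \<in> carrier G"
    and cP: "\<And>h. h \<in> H \<Longrightarrow> h \<in> power_torsion G p \<Longrightarrow> h \<otimes> c = c \<otimes> s h"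
    using insert.prems(2)[of p] by auto
  obtain n :: nat where n: "n > 0" "c [^] n = \<one>" using tg c by (auto simp: torsion_group_def)
  obtain i j :: int and m :: nat where ij: "c = c [^] i \<otimes> c [^] j" "c [^] i \<in> power_torsion G p"
    "(c [^] j) [^] m = \<one>" "\<not> p dvd m"
    using split_prime_part[OF c n(2,1) p] by metis
  define a b where "a = c [^] i" and "b = c [^] j"
  have a: "a \<in> power_torsion G p" "a \<in> carrier G" using ij(2) c by (auto simp: a_def)
  have b: "b \<in> carrier G" "b [^] m = \<one>" using ij(3) c by (auto simp: b_def)
  have pm: "coprime p m" using ij(4) p by (rule prime_imp_coprime[rotated])
  have bC: "x \<otimes> b = b \<otimes> x" if "x \<in> power_torsion G p" for x
    using commute_with_power_torsion[OF ln that b pm] .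
  have c_eq: "c = b \<otimes> a" using ij(1) bC[OF a(1)] by (simp add: a_def b_def)
  have torc: "x \<in> carrier G" if "x \<in> power_torsion G q" for x q
    using that by (simp add: power_torsion_def)
  have aP: "h \<otimes> a = a \<otimes> s h" if h: "h \<in> H" "h \<in> power_torsion G p" for h
  proof -
    have sh: "s h \<in> carrier G" using s h torc by blast
    have "b \<otimes> (h \<otimes> a) = h \<otimes> c"
      using bC[OF h(2)] a b torc[OF h(2)] by (simp add: c_eq flip: m_assoc)
    also have "\<dots> = b \<otimes> (a \<otimes> s h)" using cP[OF h] a b sh by (simp add: c_eq m_assoc)
    finally show ?thesis using a b sh torc[OF h(2)] by simp
  qed
  have aC: "x \<otimes> a = a \<otimes> x" if "Factorial_Ring.prime q" "q \<noteq> p" "x \<in> power_torsion G q" for q x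
    using power_torsions_commute[OF ln that(3) a(1)] primes_coprime[OF that(1) p that(2)] by blast
  show ?case
  proof (intro bexI[of _ "g \<otimes> a"] conjI ballI allI impI)
    fix q h assume q: "q \<in> insert p F" and "h \<in> H \<inter> power_torsion G q"
    then have h: "h \<in> H" "h \<in> power_torsion G q" by auto
    have hc: "h \<in> carrier G" using h(2) torc by blast
    have sh: "s h \<in> power_torsion G q" using s h by blast
    show "h \<otimes> (g \<otimes> a) = g \<otimes> a \<otimes> s h"
    proof (cases "q = p")
      case True
      have "h \<otimes> (g \<otimes> a) = g \<otimes> (h \<otimes> a)"
        using gC[OF p insert.hyps(2)] h True hc g a by (simp flip: m_assoc)
      then show ?thesis using aP h True g a torc[OF sh] by (simp add: m_assoc)
    next
      case False
      then have qF: "q \<in> F" using q by simp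
      have "h \<otimes> (g \<otimes> a) = g \<otimes> (s h \<otimes> a)"
        using gF[OF qF h] hc g a torc[OF sh] by (simp flip: m_assoc)
      then show ?thesis
        using aC[OF _ False sh] insert.prems(1)[OF q] g a torc[OF sh] by (simp add: m_assoc)
    qed
  next
    fix q x assume q: "Factorial_Ring.prime q" "q \<notin> insert p F" and x: "x \<in> power_torsion G q"
    have "x \<otimes> (g \<otimes> a) = g \<otimes> (x \<otimes> a)"
      using gC[OF q(1) _ x] q(2) torc[OF x] g a by (simp flip: m_assoc)
    then show "x \<otimes> (g \<otimes> a) = g \<otimes> a \<otimes> x"
      using aC[OF q(1) _ x] q(2) torc[OF x] g a by (simp add: m_assoc)
  qed (use g a in simp)
qed

text \<open>
  Induction on an exponent of \<open>h\<close>: splitting off the \<open>p\<close>-part of \<open>h\<close>, for a prime divisor \<open>p\<close> of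
  the exponent, leaves an element of \<open>H\<close> with a smaller exponent.
\<close>

lemma (in group) conjugator_from_prime_parts:
  assumes tg: "torsion_group G" and H: "subgroup H G" and g: "g \<in> carrier G"
    and s: "\<And>h. h \<in> H \<Longrightarrow> s h \<in> carrier G"
    and s_hom: "\<And>h k. h \<in> H \<Longrightarrow> k \<in> H \<Longrightarrow> s (h \<otimes> k) = s h \<otimes> s k"
    and loc: "\<And>p h. Factorial_Ring.prime (p::nat) \<Longrightarrow> h \<in> H \<Longrightarrow> h \<in> power_torsion G p \<Longrightarrow> h \<otimes> g = g \<otimes> s h"
    and h: "h \<in> H"
  shows "h \<otimes> g = g \<otimes> s h"
proof -
  have Hc: "h \<in> carrier G" if "h \<in> H" for h using that subgroup.subset[OF H] by blast
  have "h \<otimes> g = g \<otimes> s h" if "h \<in> H" "h [^] n = \<one>" "n > 0" for n :: nat and h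
    using that
  proof (induction n arbitrary: h rule: less_induct)
    case (less n)
    note hH = \<open>h \<in> H\<close>
    show ?case
    proof (cases "n = 1")
      case True
      then have "h = \<one>" using less.prems(2) Hc[OF hH] by simp
      \<comment> \<open>The identity is a \<open>p\<close>-element for every prime \<open>p\<close>.\<close>
      then have "h \<in> power_torsion G 2" by (auto simp: power_torsion_def)
      then show ?thesis using loc[OF two_is_prime_nat hH] by blast
    next
      case False
      then obtain p where p: "Factorial_Ring.prime p" "p dvd n" using prime_factor_nat by blast
      obtain i j :: int and m :: nat where ij: "h = h [^] i \<otimes> h [^] j" "h [^] i \<in> power_torsion G p"
        "(h [^] j) [^] m = \<one>" "\<not> p dvd m" "m dvd n"
        using split_prime_part[OF Hc[OF hH] less.prems(2,3) p(1)] by metis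
      define a b where "a = h [^] i" and "b = h [^] j"
      have aH: "a \<in> H" and bH: "b \<in> H"
        unfolding a_def b_def using subgroup_int_pow_closed[OF H hH] by auto
      have ab: "h = a \<otimes> b" using ij(1) by (simp add: a_def b_def)
      have "m \<noteq> n" using ij(4) p(2) by blast
      moreover have "m > 0" using ij(4) by (cases m) auto
      moreover have "m \<le> n" using ij(5) less.prems(3) by (rule dvd_imp_le)
      ultimately have "b \<otimes> g = g \<otimes> s b"
        using less.IH[of m b] bH ij(3) by (simp add: b_def)
      moreover have "a \<otimes> g = g \<otimes> s a" using loc[OF p(1) aH] ij(2) by (simp add: a_def)
      ultimately have "a \<otimes> (b \<otimes> g) = g \<otimes> (s a \<otimes> s b)"
        using s[OF aH] s[OF bH] Hc[OF aH] g by (metis m_assoc)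
      then show ?thesis
        using s_hom[OF aH bH] Hc[OF aH] Hc[OF bH] g by (simp add: ab m_assoc)
    qed
  qed
  moreover obtain n :: nat where "n > 0" "h [^] n = \<one>" using tg Hc[OF h] by (auto simp: torsion_group_def)
  ultimately show ?thesis using h by blast
qed

text \<open>
  If \<open>H\<close> has a nontrivial \<open>p\<close>-element, then \<open>G\<close> has an element of order \<open>p\<close>, so \<open>p\<close> is not
  invertible in \<open>R\<close> and \<open>coleman\<close> applies. Otherwise any element of the support will do, and
  there is one since the augmentation of \<open>u\<close> is not zero.
\<close>

lemma (in group_algebra) unit_conjugation_on_prime_part:
  assumes ad: "adapted_ring G R" and ln: "locally_nilpotent_group G" and H: "subgroup H G"
    and s: "\<And>h. h \<in> H \<Longrightarrow> s h \<in> carrier G"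
    and s_hom: "\<And>h k. h \<in> H \<Longrightarrow> k \<in> H \<Longrightarrow> s (h \<otimes>\<^bsub>G\<^esub> k) = s h \<otimes>\<^bsub>G\<^esub> s k"
    and u: "u \<in> Units RG"
    and conj: "\<And>h. h \<in> H \<Longrightarrow> of_group h \<otimes>\<^bsub>RG\<^esub> u = u \<otimes>\<^bsub>RG\<^esub> of_group (s h)"
    and p: "Factorial_Ring.prime (p::nat)"
  shows "\<exists>g\<in>supp u. \<forall>h\<in>H \<inter> power_torsion G p. h \<otimes>\<^bsub>G\<^esub> g = g \<otimes>\<^bsub>G\<^esub> s h"
proof -
  have uc: "u \<in> carrier RG" using u by (auto simp: Units_def)
  have aug: "augmentation u \<in> Units R" using u by (rule augmentation_Units)
  have P: "subgroup (H \<inter> power_torsion G p) G"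
    using H G.power_torsion_subgroup[OF ln] by (rule G.subgroups_Inter_pair)
  show ?thesis
  proof (cases "H \<inter> power_torsion G p \<subseteq> {\<one>\<^bsub>G\<^esub>}")
    case True
    have dom: "domain R" using ad by (simp add: adapted_ring_def)
    have "supp u \<noteq> {}"
    proof
      assume "supp u = {}"
      then have "augmentation u = \<zero>" by (simp add: augmentation_def)
      then show False using aug domain.one_not_zero[OF dom] by (auto simp: Units_def)
    qed
    then obtain g where g: "g \<in> supp u" by blast
    have gc: "g \<in> carrier G" using g uc by (auto simp: carrier_RG)
    have one: "\<one>\<^bsub>G\<^esub> \<in> H" using H by (rule subgroup.one_closed)
    have "s \<one>\<^bsub>G\<^esub> \<otimes>\<^bsub>G\<^esub> s \<one>\<^bsub>G\<^esub> = s \<one>\<^bsub>G\<^esub>" using s_hom[OF one one] by simp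
    then have "s \<one>\<^bsub>G\<^esub> = \<one>\<^bsub>G\<^esub>" using s[OF one] by simp
    then show ?thesis using True g gc by (intro bexI[of _ g]) auto
  next
    case False
    then obtain x where "x \<in> power_torsion G p" "x \<noteq> \<one>\<^bsub>G\<^esub>" by blast
    then have "add_pow R p \<one> \<notin> Units R"
      using G.ex_ord_eq_prime[OF p] ad p unfolding adapted_ring_def by blast
    then show ?thesis
      using coleman[OF P _ p _ _ uc aug] s s_hom conj by blast
  qed
qed

text \<open>
  The finite set \<open>F\<close> of primes dividing the order of some element of the support of \<open>u\<close> is
  handled by gluing. For a prime \<open>p\<close> outside \<open>F\<close>, the conjugator from the support has order prime
  to \<open>p\<close>, hence commutes with \<open>p\<close>-elements, and so \<open>s\<close> fixes the \<open>p\<close>-elements of \<open>H\<close>; the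
  glued conjugator commutes with them too.
\<close>

lemma (in group_algebra) unit_conjugation_is_group_conjugation:
  assumes ad: "adapted_ring G R" and ln: "locally_nilpotent_group G" and tg: "torsion_group G"
    and H: "subgroup H G"
    and s: "\<And>h. h \<in> H \<Longrightarrow> s h \<in> carrier G"
    and s_hom: "\<And>h k. h \<in> H \<Longrightarrow> k \<in> H \<Longrightarrow> s (h \<otimes>\<^bsub>G\<^esub> k) = s h \<otimes>\<^bsub>G\<^esub> s k"
    and u: "u \<in> Units RG"
    and conj: "\<And>h. h \<in> H \<Longrightarrow> of_group h \<otimes>\<^bsub>RG\<^esub> u = u \<otimes>\<^bsub>RG\<^esub> of_group (s h)"
  shows "\<exists>g\<in>carrier G. \<forall>h\<in>H. h \<otimes>\<^bsub>G\<^esub> g = g \<otimes>\<^bsub>G\<^esub> s h"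
proof -
  have uc: "u \<in> carrier RG" using u by (auto simp: Units_def)
  have fin: "finite (supp u)" and suppc: "supp u \<subseteq> carrier G" using uc by (auto simp: carrier_RG)
  have Hc: "h \<in> carrier G" if "h \<in> H" for h using that subgroup.subset[OF H] by blast
  interpret S: group_hom "G\<lparr>carrier := H\<rparr>" G s
    using G.subgroup_imp_group[OF H] s s_hom
    by (intro group_hom.intro group_hom_axioms.intro homI) (auto simp: G.group_axioms)
  have s_tors: "s ` (H \<inter> power_torsion G n) \<subseteq> power_torsion G n" for n
  proof clarify
    fix h assume h: "h \<in> H" "h \<in> power_torsion G n"
    obtain k where "h [^]\<^bsub>G\<^esub> (n ^ k) = \<one>\<^bsub>G\<^esub>" using h(2) unfolding power_torsion_def by blast
    then have "s h [^]\<^bsub>G\<^esub> (n ^ k) = \<one>\<^bsub>G\<^esub>"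
      using S.hom_nat_pow[of h "n ^ k"] S.hom_one h(1) by (simp flip: G.nat_pow_consistent)
    then show "s h \<in> power_torsion G n" using s[OF h(1)] unfolding power_torsion_def by blast
  qed
  have loc: "\<exists>c\<in>supp u. \<forall>h\<in>H \<inter> power_torsion G p. h \<otimes>\<^bsub>G\<^esub> c = c \<otimes>\<^bsub>G\<^esub> s h"
    if "Factorial_Ring.prime p" for p :: nat
    using unit_conjugation_on_prime_part[OF ad ln H s s_hom u conj that] .
  have ord_pos: "G.ord x > 0" if "x \<in> supp u" for x
  proof -
    obtain n :: nat where "n > 0" "x [^]\<^bsub>G\<^esub> n = \<one>\<^bsub>G\<^esub>"
      using tg subsetD[OF suppc \<open>x \<in> supp u\<close>] unfolding torsion_group_def by blast
    then show ?thesis using G.pow_eq_id[of x n] subsetD[OF suppc \<open>x \<in> supp u\<close>] by (auto intro: gr0I)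
  qed
  define F where "F = {p::nat. Factorial_Ring.prime p \<and> (\<exists>x\<in>supp u. p dvd G.ord x)}"
  have "F \<subseteq> (\<Union>x\<in>supp u. {..G.ord x})"
    using ord_pos by (auto simp: F_def dest: dvd_imp_le)
  then have finF: "finite F" using fin finite_subset by blast
  obtain g where g: "g \<in> carrier G"
    and gF: "\<And>p h. p \<in> F \<Longrightarrow> h \<in> H \<Longrightarrow> h \<in> power_torsion G p \<Longrightarrow> h \<otimes>\<^bsub>G\<^esub> g = g \<otimes>\<^bsub>G\<^esub> s h"
    and gC: "\<And>q x. Factorial_Ring.prime q \<Longrightarrow> q \<notin> F \<Longrightarrow> x \<in> power_torsion G q \<Longrightarrow> x \<otimes>\<^bsub>G\<^esub> g = g \<otimes>\<^bsub>G\<^esub> x"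
  proof -
    have "\<exists>g\<in>carrier G. (\<forall>p\<in>F. \<forall>h\<in>H \<inter> power_torsion G p. h \<otimes>\<^bsub>G\<^esub> g = g \<otimes>\<^bsub>G\<^esub> s h) \<and>
      (\<forall>q. Factorial_Ring.prime q \<longrightarrow> q \<notin> F \<longrightarrow> (\<forall>x\<in>power_torsion G q. x \<otimes>\<^bsub>G\<^esub> g = g \<otimes>\<^bsub>G\<^esub> x))"
    proof (rule G.combine_local_conjugators[OF ln tg s_tors finF])
      show "Factorial_Ring.prime p" if "p \<in> F" for p using that by (simp add: F_def)
      then show "\<exists>c\<in>carrier G. \<forall>h\<in>H \<inter> power_torsion G p. h \<otimes>\<^bsub>G\<^esub> c = c \<otimes>\<^bsub>G\<^esub> s h"
        if "p \<in> F" for p using that loc suppc by blast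
    qed
    then show thesis using that by blast
  qed
  have "h \<otimes>\<^bsub>G\<^esub> g = g \<otimes>\<^bsub>G\<^esub> s h"
    if p: "Factorial_Ring.prime (p::nat)" and h: "h \<in> H" "h \<in> power_torsion G p" for p h
  proof (cases "p \<in> F")
    case True
    then show ?thesis using gF h by blast
  next
    case False
    obtain c where c: "c \<in> supp u" "h \<otimes>\<^bsub>G\<^esub> c = c \<otimes>\<^bsub>G\<^esub> s h" using loc[OF p] h by blast
    have cc: "c \<in> carrier G" using c suppc by blast
    have "\<not> p dvd G.ord c" using False p c(1) by (auto simp: F_def)
    then have "coprime p (G.ord c)" using p by (rule prime_imp_coprime[rotated])
    then have "h \<otimes>\<^bsub>G\<^esub> c = c \<otimes>\<^bsub>G\<^esub> h"
      by (rule G.commute_with_power_torsion[OF ln h(2) cc G.pow_ord_eq_1[OF cc]])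
    then have "s h = h" using c(2) cc s[OF h(1)] Hc[OF h(1)] by simp
    then show ?thesis using gC[OF p False h(2)] by simp
  qed
  then have "\<forall>h\<in>H. h \<otimes>\<^bsub>G\<^esub> g = g \<otimes>\<^bsub>G\<^esub> s h"
    using G.conjugator_from_prime_parts[OF tg H g s s_hom] by blast
  then show ?thesis using g by blast
qed

section \<open>Normalizers\<close>

lemma (in group) mem_normalizer_iff:
  assumes "K \<subseteq> carrier G"
  shows "x \<in> normalizer G K \<longleftrightarrow> x \<in> carrier G \<and> (\<lambda>k. inv x \<otimes> k \<otimes> x) ` K = K"
proof -
  have "inv x <# K #> x = (\<lambda>k. inv x \<otimes> k \<otimes> x) ` K" by (auto simp: l_coset_def r_coset_def)
  then show ?thesis using normalizer_eq[OF assms] by auto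
qed

text \<open>
  Replacing \<open>G\<close> by its image, the assumption says that every automorphism of \<open>K\<close> induced by an
  element \<open>u\<close> of \<open>H\<close> is also induced by an element \<open>g\<close> of \<open>G\<close>; then \<open>g\<^sup>-\<^sup>1 u\<close> centralizes \<open>K\<close>.
\<close>

lemma (in group_hom) normalizer_image_eq_mult_centralizer:
  assumes inj: "inj_on h (carrier G)" and K: "subgroup K G"
    and conj: "\<And>u s. \<lbrakk>u \<in> carrier H; \<And>k. k \<in> K \<Longrightarrow> s k \<in> K;
        \<And>k l. k \<in> K \<Longrightarrow> l \<in> K \<Longrightarrow> s (k \<otimes> l) = s k \<otimes> s l;
        \<And>k. k \<in> K \<Longrightarrow> h k \<otimes>\<^bsub>H\<^esub> u = u \<otimes>\<^bsub>H\<^esub> h (s k)\<rbrakk>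
        \<Longrightarrow> \<exists>g\<in>carrier G. \<forall>k\<in>K. k \<otimes> g = g \<otimes> s k"
  shows "normalizer H (h ` K) = h ` normalizer G K <#>\<^bsub>H\<^esub> centralizer H (h ` K)"
proof (rule Set.set_eqI, rule iffI)
  have Kc: "k \<in> carrier G" if "k \<in> K" for k using that subgroup.subset[OF K] by blast
  then have KG: "K \<subseteq> carrier G" and hKH: "h ` K \<subseteq> carrier H" by auto
  {
    fix u assume "u \<in> normalizer H (h ` K)"
    then have u: "u \<in> carrier H" and uK: "(\<lambda>k. inv\<^bsub>H\<^esub> u \<otimes>\<^bsub>H\<^esub> k \<otimes>\<^bsub>H\<^esub> u) ` h ` K = h ` K"
      using H.mem_normalizer_iff[OF hKH] by auto
    have "\<exists>l\<in>K. inv\<^bsub>H\<^esub> u \<otimes>\<^bsub>H\<^esub> h k \<otimes>\<^bsub>H\<^esub> u = h l" if "k \<in> K" for k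
      using uK that by blast
    then obtain s where s: "\<And>k. k \<in> K \<Longrightarrow> s k \<in> K"
      and hs: "\<And>k. k \<in> K \<Longrightarrow> inv\<^bsub>H\<^esub> u \<otimes>\<^bsub>H\<^esub> h k \<otimes>\<^bsub>H\<^esub> u = h (s k)"
      by metis
    have hu: "h k \<otimes>\<^bsub>H\<^esub> u = u \<otimes>\<^bsub>H\<^esub> h (s k)" if k: "k \<in> K" for k
      using hs[OF k, symmetric] u Kc[OF k] by (simp flip: H.m_assoc)
    have s_hom: "s (k \<otimes> l) = s k \<otimes> s l" if k: "k \<in> K" and l: "l \<in> K" for k l
    proof -
      have kl: "k \<otimes> l \<in> K" using K k l by (rule subgroup.m_closed)
      have "u \<otimes>\<^bsub>H\<^esub> h (s (k \<otimes> l)) = h k \<otimes>\<^bsub>H\<^esub> (h l \<otimes>\<^bsub>H\<^esub> u)"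
        using hu[OF kl] Kc[OF k] Kc[OF l] u by (simp add: H.m_assoc)
      also have "\<dots> = (h k \<otimes>\<^bsub>H\<^esub> u) \<otimes>\<^bsub>H\<^esub> h (s l)"
        using hu[OF l] Kc[OF k] Kc[OF s[OF l]] u by (simp add: H.m_assoc)
      also have "\<dots> = u \<otimes>\<^bsub>H\<^esub> h (s k \<otimes> s l)"
        using hu[OF k] Kc[OF s[OF k]] Kc[OF s[OF l]] u by (simp add: H.m_assoc)
      finally have "h (s (k \<otimes> l)) = h (s k \<otimes> s l)"
        using u Kc[OF s[OF kl]] Kc[OF s[OF k]] Kc[OF s[OF l]] by (simp del: hom_mult)
      then show ?thesis
        using inj_onD[OF inj] Kc[OF s[OF kl]] Kc[OF s[OF k]] Kc[OF s[OF l]] by (simp del: hom_mult)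
    qed
    obtain g where g: "g \<in> carrier G" and gs: "\<And>k. k \<in> K \<Longrightarrow> k \<otimes> g = g \<otimes> s k"
      using conj[OF u s s_hom hu] by blast
    have "h ` s ` K = h ` K" using uK hs by (simp add: image_image)
    moreover have "s ` K \<subseteq> carrier G" using s Kc by blast
    ultimately have sK: "s ` K = K" using inj_on_image_eq_iff[OF inj _ KG] by blast
    have "inv g \<otimes> k \<otimes> g = s k" if k: "k \<in> K" for k
    proof -
      have "inv g \<otimes> k \<otimes> g = inv g \<otimes> (g \<otimes> s k)"
        using g Kc[OF k] by (simp only: G.m_assoc G.inv_closed gs[OF k])
      then show ?thesis using g Kc[OF s[OF k]] by (simp flip: G.m_assoc)
    qed
    then have "(\<lambda>k. inv g \<otimes> k \<otimes> g) ` K = K" using sK by simp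
    then have gN: "g \<in> normalizer G K" using g G.mem_normalizer_iff[OF KG] by simp
    let ?c = "inv\<^bsub>H\<^esub> (h g) \<otimes>\<^bsub>H\<^esub> u"
    have "?c \<otimes>\<^bsub>H\<^esub> h k = h k \<otimes>\<^bsub>H\<^esub> ?c" if "k \<in> K" for k
    proof -
      have "k \<in> s ` K" unfolding sK by (rule that)
      then obtain l where l: "l \<in> K" "k = s l" by (rule imageE) simp
      define e a b where "e = h g" and "a = h l" and "b = h (s l)"
      have ec: "e \<in> carrier H" and ac: "a \<in> carrier H" and bc: "b \<in> carrier H"
        unfolding e_def a_def b_def using g Kc[OF l(1)] Kc[OF s[OF l(1)]] by simp_all
      have ae: "a \<otimes>\<^bsub>H\<^esub> e = e \<otimes>\<^bsub>H\<^esub> b"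
        unfolding e_def a_def b_def using gs[OF l(1)] g Kc[OF l(1)] Kc[OF s[OF l(1)]]
        by (simp only: flip: hom_mult)
      have au: "a \<otimes>\<^bsub>H\<^esub> u = u \<otimes>\<^bsub>H\<^esub> b" unfolding a_def b_def by (rule hu[OF l(1)])
      have "b = inv\<^bsub>H\<^esub> e \<otimes>\<^bsub>H\<^esub> (a \<otimes>\<^bsub>H\<^esub> e)"
        unfolding ae using ec bc by (simp flip: H.m_assoc)
      then have "b \<otimes>\<^bsub>H\<^esub> inv\<^bsub>H\<^esub> e = inv\<^bsub>H\<^esub> e \<otimes>\<^bsub>H\<^esub> a"
        using ec ac by (simp add: H.m_assoc)
      then have "b \<otimes>\<^bsub>H\<^esub> (inv\<^bsub>H\<^esub> e \<otimes>\<^bsub>H\<^esub> u) = inv\<^bsub>H\<^esub> e \<otimes>\<^bsub>H\<^esub> (a \<otimes>\<^bsub>H\<^esub> u)"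
        using ec ac bc u by (simp flip: H.m_assoc)
      also have "\<dots> = inv\<^bsub>H\<^esub> e \<otimes>\<^bsub>H\<^esub> u \<otimes>\<^bsub>H\<^esub> b"
        unfolding au using ec bc u by (simp add: H.m_assoc)
      finally show ?thesis unfolding l(2) e_def b_def by (rule sym)
    qed
    then have "?c \<in> centralizer H (h ` K)" using g u by (auto simp: centralizer_def)
    moreover have "u = h g \<otimes>\<^bsub>H\<^esub> ?c" using g u by (simp flip: H.m_assoc)
    ultimately show "u \<in> h ` normalizer G K <#>\<^bsub>H\<^esub> centralizer H (h ` K)"
      using gN unfolding set_mult_def by blast
  }
  {
    fix x assume "x \<in> h ` normalizer G K <#>\<^bsub>H\<^esub> centralizer H (h ` K)"
    then obtain g c where gN: "g \<in> normalizer G K" and cC: "c \<in> centralizer H (h ` K)"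
      and x: "x = h g \<otimes>\<^bsub>H\<^esub> c" unfolding set_mult_def by blast
    have g: "g \<in> carrier G" and gK: "(\<lambda>k. inv g \<otimes> k \<otimes> g) ` K = K"
      using gN G.mem_normalizer_iff[OF KG] by auto
    have c: "c \<in> carrier H" and ck: "\<And>k. k \<in> K \<Longrightarrow> c \<otimes>\<^bsub>H\<^esub> h k = h k \<otimes>\<^bsub>H\<^esub> c"
      using cC by (auto simp: centralizer_def)
    have "inv\<^bsub>H\<^esub> x \<otimes>\<^bsub>H\<^esub> h k \<otimes>\<^bsub>H\<^esub> x = h (inv g \<otimes> k \<otimes> g)" if k: "k \<in> K" for k
    proof -
      have l: "inv g \<otimes> k \<otimes> g \<in> K" using gK k by blast
      have "inv\<^bsub>H\<^esub> x \<otimes>\<^bsub>H\<^esub> h k \<otimes>\<^bsub>H\<^esub> x = inv\<^bsub>H\<^esub> c \<otimes>\<^bsub>H\<^esub> (h (inv g \<otimes> k \<otimes> g) \<otimes>\<^bsub>H\<^esub> c)"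
        using g c Kc[OF k] unfolding x by (simp add: H.inv_mult_group H.m_assoc)
      also have "\<dots> = inv\<^bsub>H\<^esub> c \<otimes>\<^bsub>H\<^esub> (c \<otimes>\<^bsub>H\<^esub> h (inv g \<otimes> k \<otimes> g))"
        by (simp only: ck[OF l])
      also have "\<dots> = h (inv g \<otimes> k \<otimes> g)"
        using c Kc[OF l] by (simp del: hom_mult hom_inv flip: H.m_assoc)
      finally show ?thesis .
    qed
    then have "(\<lambda>k. inv\<^bsub>H\<^esub> x \<otimes>\<^bsub>H\<^esub> k \<otimes>\<^bsub>H\<^esub> x) ` h ` K = h ` (\<lambda>k. inv g \<otimes> k \<otimes> g) ` K"
      unfolding image_image by (rule image_cong[OF refl])
    then show "x \<in> normalizer H (h ` K)"
      using gK g c H.mem_normalizer_iff[OF hKH] by (simp add: x)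
  }
qed

theorem (in group_algebra) normalizer_units_eq:
  assumes ad: "adapted_ring G R" and ln: "locally_nilpotent_group G" and tg: "torsion_group G"
    and H: "subgroup H G"
  shows "normalizer (units_of RG) (of_group ` H) =
    of_group ` normalizer G H <#>\<^bsub>units_of RG\<^esub> centralizer (units_of RG) (of_group ` H)"
proof -
  interpret RG: Group.monoid RG by (rule monoid_RG)
  interpret E: group_hom G "units_of RG" of_group
    by (intro group_hom.intro group_hom_axioms.intro homI G.group_axioms RG.units_group)
      (simp_all add: units_of_carrier units_of_mult of_group_Units of_group_hom)
  have nontriv: "\<one> \<noteq> \<zero>" using ad by (auto simp: adapted_ring_def dest: domain.one_not_zero)
  show ?thesis
  proof (rule E.normalizer_image_eq_mult_centralizer[OF _ H])
    show "inj_on of_group (carrier G)"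
    proof (rule inj_onI)
      fix x y assume "of_group x = of_group y"
      then have "of_group x x = of_group y x" by simp
      then show "x = y" using nontriv by (simp add: group_ring_of_def split: if_splits)
    qed
  next
    fix u s
    assume "u \<in> carrier (units_of RG)" "\<And>k. k \<in> H \<Longrightarrow> s k \<in> H"
      "\<And>k l. k \<in> H \<Longrightarrow> l \<in> H \<Longrightarrow> s (k \<otimes>\<^bsub>G\<^esub> l) = s k \<otimes>\<^bsub>G\<^esub> s l"
      "\<And>k. k \<in> H \<Longrightarrow> of_group k \<otimes>\<^bsub>units_of RG\<^esub> u = u \<otimes>\<^bsub>units_of RG\<^esub> of_group (s k)"
    then show "\<exists>g\<in>carrier G. \<forall>k\<in>H. k \<otimes>\<^bsub>G\<^esub> g = g \<otimes>\<^bsub>G\<^esub> s k"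
      using subgroup.mem_carrier[OF H]
      by (intro unit_conjugation_is_group_conjugation[OF ad ln tg H])
        (simp_all add: units_of_carrier units_of_mult)
  qed
qed

lemma (in group) lower_central_series_subgroup_mono:
  assumes K: "subgroup K G"
  shows "lower_central_series (G\<lparr>carrier := K\<rparr>) i \<subseteq> lower_central_series G i"
proof (induction i)
  case 0
  then show ?case using subgroup.subset[OF K] by simp
next
  case (Suc i)
  let ?K = "G\<lparr>carrier := K\<rparr>"
  interpret K: group ?K using K by (rule subgroup_imp_group)
  let ?S = "{x \<otimes>\<^bsub>?K\<^esub> y \<otimes>\<^bsub>?K\<^esub> inv\<^bsub>?K\<^esub> x \<otimes>\<^bsub>?K\<^esub> inv\<^bsub>?K\<^esub> y |x y. x \<in> lower_central_series ?K i \<and> y \<in> carrier ?K}"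
  have LK: "lower_central_series ?K i \<subseteq> K" using K.lower_central_series_subset by simp
  have "?S \<subseteq> K"
  proof clarify
    fix x y assume "x \<in> lower_central_series ?K i" "y \<in> carrier ?K"
    then have "x \<in> carrier ?K" "y \<in> carrier ?K" using LK by auto
    then have "x \<otimes>\<^bsub>?K\<^esub> y \<otimes>\<^bsub>?K\<^esub> inv\<^bsub>?K\<^esub> x \<otimes>\<^bsub>?K\<^esub> inv\<^bsub>?K\<^esub> y \<in> carrier ?K"
      by (simp only: K.m_closed K.inv_closed)
    then show "x \<otimes>\<^bsub>?K\<^esub> y \<otimes>\<^bsub>?K\<^esub> inv\<^bsub>?K\<^esub> x \<otimes>\<^bsub>?K\<^esub> inv\<^bsub>?K\<^esub> y \<in> K" by simp
  qed
  then have "generate ?K ?S = generate G ?S" using K by (rule generate_consistent)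
  also have "\<dots> \<subseteq> generate G {x \<otimes> y \<otimes> inv x \<otimes> inv y |x y. x \<in> lower_central_series G i \<and> y \<in> carrier G}"
  proof (rule mono_generate, clarify)
    fix x y assume x: "x \<in> lower_central_series ?K i" and y: "y \<in> carrier ?K"
    then have "inv\<^bsub>?K\<^esub> x = inv x" "inv\<^bsub>?K\<^esub> y = inv y"
      using LK m_inv_consistent[OF K] by auto
    then show "\<exists>x' y'. x \<otimes>\<^bsub>?K\<^esub> y \<otimes>\<^bsub>?K\<^esub> inv\<^bsub>?K\<^esub> x \<otimes>\<^bsub>?K\<^esub> inv\<^bsub>?K\<^esub> y = x' \<otimes> y' \<otimes> inv x' \<otimes> inv y' \<and>
        x' \<in> lower_central_series G i \<and> y' \<in> carrier G"
      using x y Suc subgroup.subset[OF K] by (intro exI[of _ x] exI[of _ y]) auto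
  qed
  finally show ?case unfolding lower_central_series.simps .
qed

lemma nilpotent_imp_locally_nilpotent:
  assumes "nilpotent_group G"
  shows "locally_nilpotent_group G"
proof -
  interpret group G using assms by (simp add: nilpotent_group_def)
  obtain c where c: "lower_central_series G c = {\<one>\<^bsub>G\<^esub>}"
    using assms by (auto simp: nilpotent_group_def)
  have "nilpotent_group (G\<lparr>carrier := K\<rparr>)" if K: "subgroup K G" for K
  proof -
    interpret K: group "G\<lparr>carrier := K\<rparr>" using K by (rule subgroup_imp_group)
    have "lower_central_series (G\<lparr>carrier := K\<rparr>) c \<subseteq> {\<one>\<^bsub>G\<^esub>}"
      using lower_central_series_subgroup_mono[OF K] c by blast
    moreover have "\<one>\<^bsub>G\<^esub> \<in> lower_central_series (G\<lparr>carrier := K\<rparr>) c"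
      using subgroup.one_closed[OF normal_imp_subgroup[OF K.lower_central_series_normal]] by simp
    ultimately have "lower_central_series (G\<lparr>carrier := K\<rparr>) c = {\<one>\<^bsub>G\<lparr>carrier := K\<rparr>\<^esub>}" by auto
    then show ?thesis using K.group_axioms unfolding nilpotent_group_def by blast
  qed
  then show ?thesis
    using generate_is_subgroup group_axioms by (auto simp: locally_nilpotent_group_def)
qed

lemma (in group) finite_imp_torsion_group:
  assumes "finite (carrier G)"
  shows "torsion_group G"
proof -
  have "order G > 0" using assms order_gt_0_iff_finite by blast
  then show ?thesis
    using pow_order_eq_1 group_axioms by (auto simp: torsion_group_def)
qed

theorem theorem9:
  fixes G :: "('g, 'm) monoid_scheme" and R :: "('r, 'n) ring_scheme"
  assumes "group G" and "adapted_ring G R"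
  shows "(locally_nilpotent_group G \<and> torsion_group G \<longrightarrow>
            (\<forall>H. subgroup H G \<longrightarrow>
               normalizer (group_ring_units R G) (group_ring_of R G ` H) =
               group_ring_of R G ` normalizer G H
                 <#>\<^bsub>group_ring_units R G\<^esub>
               centralizer (group_ring_units R G) (group_ring_of R G ` H))) \<and>
         (finite (carrier G) \<and> nilpotent_group G \<longrightarrow>
            (\<forall>H. subgroup H G \<longrightarrow>
               normalizer (group_ring_units R G) (group_ring_of R G ` H) =
               group_ring_of R G ` normalizer G H
                 <#>\<^bsub>group_ring_units R G\<^esub>
               centralizer (group_ring_units R G) (group_ring_of R G ` H)))"
proof -
  interpret group_algebra R G
    using assms by (intro group_algebra.intro) (auto simp: adapted_ring_def domain_def)
  show ?thesis
    using normalizer_units_eq[OF assms(2)] nilpotent_imp_locally_nilpotent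
      group.finite_imp_torsion_group[OF assms(1)] by blast
qed

end
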